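(* For any $n\ge 2$ the assignment $T_i\mapsto s_i+(1-q)D_i$, $i=1,\ldots,n-1$, defines an injective homomorphism of $\mathbb{Z}[q,q^{-1}]$-algebras $\varphi:H_q(S_n)\hookrightarrow \mathbf{H}(S_n)\otimes_{\mathbb{Z}} \mathbb{Z}[q,q^{-1}]$.
   Context: For $n\ge 2$, $\mathbf{H}(S_n)$ denotes the (unital associative) $\mathbb{Z}$-algebra generated by $s_i$ and $D_i$, $i=1,\ldots,n-1$, subject to the relations: (1) $s_i^2=1$, $s_iD_i+D_is_i=s_i-1$, $D_i^2=D_i$ for $i=1,\ldots,n-1$; (2) $s_js_i=s_is_j$, $D_js_i=s_iD_j$, $D_jD_i=D_iD_j$ if $|i-j|>1$; (3) $s_js_is_j=s_is_js_i$, $D_is_js_i=s_js_iD_j$, $D_js_iD_j=s_iD_jD_i+D_iD_js_i+s_iD_js_i$ if $|i-j|=1$. The Hecke algebra $H_q(S_n)$ is the algebra generated over $\mathbb{Z}[q,q^{-1}]$ by $T_1,\ldots,T_{n-1}$ subject to the braid relations $T_iT_jT_i=T_jT_iT_j$ if $|i-j|=1$ and $T_iT_j=T_jT_i$ if $|i-j|>1$, and the quadratic relations $T_i^2=(1-q)T_i+q$. *)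

theory Defs
  imports "HOL-Algebra.Module" "HOL-Algebra.QuotRing" "HOL-Algebra.Free_Abelian_Groups"
begin

section \<open>Unital associative algebras\<close>

text \<open>The library locale \<^locale>\<open>algebra\<close> requires a commutative multiplication.\<close>

locale assoc_algebra = module R A + ring A for R (structure) and A (structure) +
  assumes smult_mult_left:
      "\<lbrakk>c \<in> carrier R; x \<in> carrier A; y \<in> carrier A\<rbrakk> \<Longrightarrow> (c \<odot>\<^bsub>A\<^esub> x) \<otimes>\<^bsub>A\<^esub> y = c \<odot>\<^bsub>A\<^esub> (x \<otimes>\<^bsub>A\<^esub> y)"
    and smult_mult_right:
      "\<lbrakk>c \<in> carrier R; x \<in> carrier A; y \<in> carrier A\<rbrakk> \<Longrightarrow> x \<otimes>\<^bsub>A\<^esub> (c \<odot>\<^bsub>A\<^esub> y) = c \<odot>\<^bsub>A\<^esub> (x \<otimes>\<^bsub>A\<^esub> y)"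

definition alg_hom ::
    "('r, 'k) ring_scheme \<Rightarrow> ('r, 'a, 'm) module_scheme \<Rightarrow> ('r, 'b, 'l) module_scheme \<Rightarrow> ('a \<Rightarrow> 'b) set"
  where "alg_hom R A B =
    {h \<in> ring_hom A B. \<forall>c\<in>carrier R. \<forall>x\<in>carrier A. h (c \<odot>\<^bsub>A\<^esub> x) = c \<odot>\<^bsub>B\<^esub> h x}"

text \<open>\<^const>\<open>FactRing\<close> drops the scalar multiplication, so it is added back here, in the same
  style as \<^const>\<open>rcoset_mult\<close>.\<close>

definition quot_algebra :: "('r, 'a, 'm) module_scheme \<Rightarrow> 'a set \<Rightarrow> ('r, 'a set) module"
  where "quot_algebra A I =
    \<lparr>carrier = carrier (A Quot I), mult = monoid.mult (A Quot I), one = monoid.one (A Quot I),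
     ring.zero = ring.zero (A Quot I), add = ring.add (A Quot I),
     smult = (\<lambda>c X. \<Union>x\<in>X. I +>\<^bsub>A\<^esub> (c \<odot>\<^bsub>A\<^esub> x))\<rparr>"

lemma assoc_algebra_quot_algebraI:
  fixes R (structure) and A (structure)
  assumes R: "cring R" and I: "ideal I A"
    and closed: "\<And>c x. \<lbrakk>c \<in> carrier R; x \<in> carrier A\<rbrakk> \<Longrightarrow> c \<odot>\<^bsub>A\<^esub> x \<in> carrier A"
    and smI: "\<And>c x. \<lbrakk>c \<in> carrier R; x \<in> I\<rbrakk> \<Longrightarrow> c \<odot>\<^bsub>A\<^esub> x \<in> I"
    and r_distr: "\<And>c x y. \<lbrakk>c \<in> carrier R; x \<in> carrier A; y \<in> carrier A\<rbrakk> \<Longrightarrow>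
      c \<odot>\<^bsub>A\<^esub> (x \<oplus>\<^bsub>A\<^esub> y) = c \<odot>\<^bsub>A\<^esub> x \<oplus>\<^bsub>A\<^esub> c \<odot>\<^bsub>A\<^esub> y"
    and l_distr: "\<And>c d x. \<lbrakk>c \<in> carrier R; d \<in> carrier R; x \<in> carrier A\<rbrakk> \<Longrightarrow>
      I +>\<^bsub>A\<^esub> ((c \<oplus>\<^bsub>R\<^esub> d) \<odot>\<^bsub>A\<^esub> x) = I +>\<^bsub>A\<^esub> (c \<odot>\<^bsub>A\<^esub> x \<oplus>\<^bsub>A\<^esub> d \<odot>\<^bsub>A\<^esub> x)"
    and assoc: "\<And>c d x. \<lbrakk>c \<in> carrier R; d \<in> carrier R; x \<in> carrier A\<rbrakk> \<Longrightarrow>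
      (c \<otimes>\<^bsub>R\<^esub> d) \<odot>\<^bsub>A\<^esub> x = c \<odot>\<^bsub>A\<^esub> (d \<odot>\<^bsub>A\<^esub> x)"
    and unit: "\<And>x. x \<in> carrier A \<Longrightarrow> \<one>\<^bsub>R\<^esub> \<odot>\<^bsub>A\<^esub> x = x"
    and left: "\<And>c x y. \<lbrakk>c \<in> carrier R; x \<in> carrier A; y \<in> carrier A\<rbrakk> \<Longrightarrow>
      (c \<odot>\<^bsub>A\<^esub> x) \<otimes>\<^bsub>A\<^esub> y = c \<odot>\<^bsub>A\<^esub> (x \<otimes>\<^bsub>A\<^esub> y)"
    and right: "\<And>c x y. \<lbrakk>c \<in> carrier R; x \<in> carrier A; y \<in> carrier A\<rbrakk> \<Longrightarrow>
      x \<otimes>\<^bsub>A\<^esub> (c \<odot>\<^bsub>A\<^esub> y) = c \<odot>\<^bsub>A\<^esub> (x \<otimes>\<^bsub>A\<^esub> y)"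
  shows "assoc_algebra R (quot_algebra A I)"
    and "\<And>c x. \<lbrakk>c \<in> carrier R; x \<in> carrier A\<rbrakk> \<Longrightarrow>
      c \<odot>\<^bsub>quot_algebra A I\<^esub> (I +>\<^bsub>A\<^esub> x) = I +>\<^bsub>A\<^esub> (c \<odot>\<^bsub>A\<^esub> x)"
proof -
  interpret I: ideal I A by fact
  interpret Q: ring "A Quot I" by (rule I.quotient_is_ring)
  let ?Q = "quot_algebra A I"
  have rm: "\<And>x y. x \<in> carrier A \<Longrightarrow> y \<in> carrier A \<Longrightarrow> (I +>\<^bsub>A\<^esub> x) \<otimes>\<^bsub>?Q\<^esub> (I +>\<^bsub>A\<^esub> y) = I +>\<^bsub>A\<^esub> (x \<otimes>\<^bsub>A\<^esub> y)"
    by (simp add: quot_algebra_def FactRing_def I.rcoset_mult_add)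
  have ra: "\<And>x y. x \<in> carrier A \<Longrightarrow> y \<in> carrier A \<Longrightarrow> (I +>\<^bsub>A\<^esub> x) \<oplus>\<^bsub>?Q\<^esub> (I +>\<^bsub>A\<^esub> y) = I +>\<^bsub>A\<^esub> (x \<oplus>\<^bsub>A\<^esub> y)"
    by (simp add: quot_algebra_def FactRing_def I.a_rcos_sum)
  have car: "X \<in> carrier ?Q \<longleftrightarrow> (\<exists>x\<in>carrier A. X = I +>\<^bsub>A\<^esub> x)" for X
    by (auto simp: quot_algebra_def FactRing_def A_RCOSETS_def')
  have rs: "c \<odot>\<^bsub>?Q\<^esub> (I +>\<^bsub>A\<^esub> x) = I +>\<^bsub>A\<^esub> (c \<odot>\<^bsub>A\<^esub> x)"
    if c: "c \<in> carrier R" and x: "x \<in> carrier A" for c x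
  proof -
    have "I +>\<^bsub>A\<^esub> (c \<odot>\<^bsub>A\<^esub> y) = I +>\<^bsub>A\<^esub> (c \<odot>\<^bsub>A\<^esub> x)" if y: "y \<in> I +>\<^bsub>A\<^esub> x" for y
    proof -
      obtain h where h: "h \<in> I" "y = h \<oplus>\<^bsub>A\<^esub> x"
        using y by (auto simp: a_r_coset_def')
      have hA: "h \<in> carrier A" using h I.a_subset by auto
      have "c \<odot>\<^bsub>A\<^esub> y = c \<odot>\<^bsub>A\<^esub> h \<oplus>\<^bsub>A\<^esub> c \<odot>\<^bsub>A\<^esub> x"
        using h hA c x by (simp add: r_distr)
      then have "c \<odot>\<^bsub>A\<^esub> y \<in> I +>\<^bsub>A\<^esub> (c \<odot>\<^bsub>A\<^esub> x)"
        using smI h c by (auto simp: a_r_coset_def')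
      then show ?thesis
        using I.a_repr_independence' closed[OF c x] by metis
    qed
    then have "(\<Union>y\<in>I +>\<^bsub>A\<^esub> x. I +>\<^bsub>A\<^esub> (c \<odot>\<^bsub>A\<^esub> y)) = (\<Union>y\<in>I +>\<^bsub>A\<^esub> x. I +>\<^bsub>A\<^esub> (c \<odot>\<^bsub>A\<^esub> x))"
      by (rule SUP_cong[OF refl])
    also have "\<dots> = I +>\<^bsub>A\<^esub> (c \<odot>\<^bsub>A\<^esub> x)"
      using I.a_rcos_self[OF x] by blast
    finally show ?thesis by (simp add: quot_algebra_def)
  qed
  then show "\<And>c x. \<lbrakk>c \<in> carrier R; x \<in> carrier A\<rbrakk> \<Longrightarrow> c \<odot>\<^bsub>?Q\<^esub> (I +>\<^bsub>A\<^esub> x) = I +>\<^bsub>A\<^esub> (c \<odot>\<^bsub>A\<^esub> x)" .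
  have ringQ: "ring ?Q"
  proof (rule ringI)
    show "abelian_group ?Q"
    proof (rule abelian_groupI)
      fix X assume X: "X \<in> carrier ?Q"
      show "\<exists>Y\<in>carrier ?Q. Y \<oplus>\<^bsub>?Q\<^esub> X = \<zero>\<^bsub>?Q\<^esub>"
        using X Q.l_neg Q.a_inv_closed by (auto simp: quot_algebra_def)
    qed (simp_all add: quot_algebra_def Q.a_ac)
    show "Group.monoid ?Q"
      by (rule monoidI) (simp_all add: quot_algebra_def Q.m_assoc)
  qed (simp_all add: quot_algebra_def Q.l_distr Q.r_distr)
  show "assoc_algebra R ?Q"
    by (intro assoc_algebra.intro moduleI assoc_algebra_axioms.intro R ringQ
          ring.is_abelian_group[OF ringQ])
      (use R in \<open>auto simp: car rs ra rm closed r_distr l_distr assoc unit left right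
          I.m_closed I.a_closed cring.cring_simprules intro!: bexI\<close>)
qed

lemma assoc_algebra_quot_algebra:
  assumes "assoc_algebra R A" and "ideal I A"
  shows "assoc_algebra R (quot_algebra A I)"
proof -
  interpret A: assoc_algebra R A by fact
  interpret I: ideal I A by fact
  have "c \<odot>\<^bsub>A\<^esub> x \<in> I" if "c \<in> carrier R" "x \<in> I" for c x
  proof -
    have "x \<in> carrier A" using that I.a_subset by auto
    then have "c \<odot>\<^bsub>A\<^esub> x = (c \<odot>\<^bsub>A\<^esub> \<one>\<^bsub>A\<^esub>) \<otimes>\<^bsub>A\<^esub> x"
      using that by (simp add: A.smult_mult_left)
    then show ?thesis using that I.I_l_closed by simp
  qed
  then show ?thesis
    by (intro assoc_algebra_quot_algebraI A.R.is_cring assms(2))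
      (auto simp: A.smult_l_distr A.smult_r_distr A.smult_assoc1 A.smult_mult_left
        A.smult_mult_right)
qed


section \<open>Algebras given by generators and relations\<close>

datatype 'x free_monoid = Word (letters: "'x list")

instantiation free_monoid :: (type) monoid_add
begin

definition "0 = Word []"

definition "u + v = Word (letters u @ letters v)"

instance
  by standard (simp_all add: zero_free_monoid_def plus_free_monoid_def)

end

definition type_ring :: "'r::comm_ring_1 ring"
  where "type_ring = \<lparr>carrier = UNIV, mult = (*), one = 1, ring.zero = 0, add = (+)\<rparr>"

lemma cring_type_ring: "cring (type_ring :: 'r::comm_ring_1 ring)"
proof (rule cringI)
  show "abelian_group (type_ring :: 'r ring)"
    by (rule abelian_groupI) (auto simp: type_ring_def algebra_simps intro: exI[of _ "- _"] left_minus)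
  show "comm_monoid (type_ring :: 'r ring)"
    by (rule comm_monoidI) (auto simp: type_ring_def algebra_simps)
qed (auto simp: type_ring_def algebra_simps)

text \<open>Over a \<^class>\<open>monoid_add\<close>, \<^type>\<open>poly_mapping\<close> with its convolution product is the monoid
  algebra; hence this is the free algebra on \<open>X\<close>, as the subalgebra of the polynomials whose words
  only use letters in \<open>X\<close>. The scalar \<open>c\<close> is the constant \<open>single 0 c\<close>.\<close>

definition free_algebra :: "'x set \<Rightarrow> ('r::comm_ring_1, 'x free_monoid \<Rightarrow>\<^sub>0 'r) module"
  where "free_algebra X =
    \<lparr>carrier = {p. \<forall>w\<in>Poly_Mapping.keys p. set (letters w) \<subseteq> X},
     mult = (*), one = 1, ring.zero = 0, add = (+),
     smult = (\<lambda>c p. Poly_Mapping.single 0 c * p)\<rparr>"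

definition gen :: "'x \<Rightarrow> ('x free_monoid \<Rightarrow>\<^sub>0 'r::comm_ring_1)"
  where "gen x = Poly_Mapping.single (Word [x]) 1"

definition relations_ideal ::
    "'x set \<Rightarrow> (('x free_monoid \<Rightarrow>\<^sub>0 'r::comm_ring_1) \<Rightarrow> ('x free_monoid \<Rightarrow>\<^sub>0 'r) \<Rightarrow> bool)
      \<Rightarrow> ('x free_monoid \<Rightarrow>\<^sub>0 'r) set"
  where "relations_ideal X rel = Idl\<^bsub>free_algebra X\<^esub> {l - r | l r. rel l r}"

definition presented_algebra ::
    "'x set \<Rightarrow> (('x free_monoid \<Rightarrow>\<^sub>0 'r::comm_ring_1) \<Rightarrow> ('x free_monoid \<Rightarrow>\<^sub>0 'r) \<Rightarrow> bool)
      \<Rightarrow> ('r, ('x free_monoid \<Rightarrow>\<^sub>0 'r) set) module"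
  where "presented_algebra X rel = quot_algebra (free_algebra X) (relations_ideal X rel)"

definition presented_gen ::
    "'x set \<Rightarrow> (('x free_monoid \<Rightarrow>\<^sub>0 'r::comm_ring_1) \<Rightarrow> ('x free_monoid \<Rightarrow>\<^sub>0 'r) \<Rightarrow> bool)
      \<Rightarrow> 'x \<Rightarrow> ('x free_monoid \<Rightarrow>\<^sub>0 'r) set"
  where "presented_gen X rel x = relations_ideal X rel +>\<^bsub>free_algebra X\<^esub> gen x"

lemma single_zero_central:
  fixes p :: "'x free_monoid \<Rightarrow>\<^sub>0 'r::comm_ring_1"
  shows "p * Poly_Mapping.single 0 c = Poly_Mapping.single 0 c * p"
proof (induction p rule: update_induct)
  case const then show ?case by simp
next
  case (update f a b)
  have "Poly_Mapping.update a b f = Poly_Mapping.single a b + f"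
    using update.hyps
    by (intro poly_mapping_eqI) (auto simp: lookup_update lookup_add lookup_single in_keys_iff when_def)
  with update.IH show ?case by (simp add: mult_single mult.commute algebra_simps)
qed

lemma free_algebra_mult_closed:
  assumes "p \<in> carrier (free_algebra X)" "q \<in> carrier (free_algebra X)"
  shows "p * q \<in> carrier (free_algebra X)"
  using assms keys_mult[of p q] by (fastforce simp: free_algebra_def plus_free_monoid_def)

lemma free_algebra_add_closed:
  assumes "p \<in> carrier (free_algebra X)" "q \<in> carrier (free_algebra X)"
  shows "p + q \<in> carrier (free_algebra X)"
  using assms Poly_Mapping.keys_add[of p q] by (fastforce simp: free_algebra_def)

lemma free_algebra_const_closed: "Poly_Mapping.single 0 c \<in> carrier (free_algebra X)"
  by (simp add: free_algebra_def zero_free_monoid_def)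

lemma free_algebra_one_closed: "1 \<in> carrier (free_algebra X)"
  using free_algebra_const_closed[of 1] by simp

lemma free_algebra_uminus_closed:
  assumes "p \<in> carrier (free_algebra X)" shows "- p \<in> carrier (free_algebra X)"
  using assms by (simp add: free_algebra_def in_keys_iff)

lemma free_algebra_diff_closed:
  assumes "p \<in> carrier (free_algebra X)" "q \<in> carrier (free_algebra X)"
  shows "p - q \<in> carrier (free_algebra X)"
  using free_algebra_add_closed[OF assms(1) free_algebra_uminus_closed[OF assms(2)]] by simp

lemma gen_closed: "x \<in> X \<Longrightarrow> gen x \<in> carrier (free_algebra X)"
  by (simp add: free_algebra_def gen_def)

lemmas free_algebra_closed = free_algebra_mult_closed free_algebra_add_closed
  free_algebra_const_closed free_algebra_one_closed free_algebra_uminus_closed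
  free_algebra_diff_closed gen_closed

lemma assoc_algebra_free_algebra:
  "assoc_algebra type_ring (free_algebra X :: ('r::comm_ring_1, _) module)"
proof -
  let ?F = "free_algebra X :: ('r, 'a free_monoid \<Rightarrow>\<^sub>0 'r) module"
  have ops: "monoid.mult ?F = (*)" "monoid.one ?F = 1" "ring.zero ?F = 0" "ring.add ?F = (+)"
    "module.smult ?F = (\<lambda>c p. Poly_Mapping.single 0 c * p)"
    by (simp_all add: free_algebra_def)
  have zero: "0 \<in> carrier ?F" by (simp add: free_algebra_def)
  have ab: "abelian_group ?F"
    by (rule abelian_groupI)
      (auto simp: ops zero free_algebra_closed algebra_simps
        intro!: bexI[OF _ free_algebra_uminus_closed])
  have ring: "ring ?F"
  proof (rule ringI)
    show "Group.monoid ?F"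
      by (rule monoidI) (auto simp: ops free_algebra_closed algebra_simps)
  qed (use ab in \<open>auto simp: ops algebra_simps\<close>)
  show ?thesis
  proof (intro assoc_algebra.intro moduleI assoc_algebra_axioms.intro)
    show "cring (type_ring :: 'r ring)" by (rule cring_type_ring)
    show "x \<otimes>\<^bsub>?F\<^esub> (c \<odot>\<^bsub>?F\<^esub> y) = c \<odot>\<^bsub>?F\<^esub> (x \<otimes>\<^bsub>?F\<^esub> y)" for c x y
      by (simp add: ops mult.assoc[symmetric] single_zero_central)
  qed (use ab ring in \<open>auto simp: ops free_algebra_closed type_ring_def
          distrib_left distrib_right single_add mult_single mult.assoc[symmetric]\<close>)
qed

lemma assoc_algebra_presented_algebra:
  assumes "\<And>l r. rel l r \<Longrightarrow> l \<in> carrier (free_algebra X) \<and> r \<in> carrier (free_algebra X)"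
  shows "assoc_algebra type_ring (presented_algebra X rel)"
proof -
  interpret F: assoc_algebra type_ring "free_algebra X" by (rule assoc_algebra_free_algebra)
  have "ideal (relations_ideal X rel) (free_algebra X)"
    unfolding relations_ideal_def
    by (rule F.genideal_ideal) (use assms free_algebra_diff_closed in blast)
  then show ?thesis
    unfolding presented_algebra_def
    by (rule assoc_algebra_quot_algebra[OF F.assoc_algebra_axioms])
qed


section \<open>Tensor products over the integers\<close>

text \<open>The free abelian group on the pairs \<open>(a, b)\<close>, multiplied bilinearly by
  \<open>(a, b) (a', b') = (a a', b b')\<close>, with \<open>B\<close> acting on the second components.\<close>

definition pair_algebra ::
    "('a, 'k) ring_scheme \<Rightarrow> ('b, 'l) ring_scheme \<Rightarrow> ('b, 'a \<times> 'b \<Rightarrow>\<^sub>0 int) module"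
  where "pair_algebra A B =
    \<lparr>carrier = carrier (free_Abelian_group (carrier A \<times> carrier B)),
     mult = (\<lambda>x y. frag_extend (\<lambda>(a, b). frag_extend (\<lambda>(a', b').
               frag_of (a \<otimes>\<^bsub>A\<^esub> a', b \<otimes>\<^bsub>B\<^esub> b')) y) x),
     one = frag_of (\<one>\<^bsub>A\<^esub>, \<one>\<^bsub>B\<^esub>), ring.zero = 0, add = (+),
     smult = (\<lambda>c. frag_extend (\<lambda>(a, b). frag_of (a, c \<otimes>\<^bsub>B\<^esub> b)))\<rparr>"

inductive_set bilinearity_relators ::
    "('a, 'k) ring_scheme \<Rightarrow> ('b, 'l) ring_scheme \<Rightarrow> ('a \<times> 'b \<Rightarrow>\<^sub>0 int) set"
  for A and B
  where
    left: "\<lbrakk>a \<in> carrier A; a' \<in> carrier A; b \<in> carrier B\<rbrakk> \<Longrightarrow>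
      frag_of (a \<oplus>\<^bsub>A\<^esub> a', b) - frag_of (a, b) - frag_of (a', b) \<in> bilinearity_relators A B"
  | right: "\<lbrakk>a \<in> carrier A; b \<in> carrier B; b' \<in> carrier B\<rbrakk> \<Longrightarrow>
      frag_of (a, b \<oplus>\<^bsub>B\<^esub> b') - frag_of (a, b) - frag_of (a, b') \<in> bilinearity_relators A B"

definition tensor_kernel ::
    "('a, 'k) ring_scheme \<Rightarrow> ('b, 'l) ring_scheme \<Rightarrow> ('a \<times> 'b \<Rightarrow>\<^sub>0 int) set"
  where "tensor_kernel A B =
    generate (add_monoid (pair_algebra A B)) (bilinearity_relators A B)"

text \<open>\<open>A \<otimes>\<^sub>\<int> B\<close> for rings \<open>A\<close>, \<open>B\<close> with \<open>B\<close> commutative, as a \<open>B\<close>-algebra. Additivity in both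
  arguments already makes the tensors \<open>\<int>\<close>-balanced.\<close>

definition tensor_algebra ::
    "('a, 'k) ring_scheme \<Rightarrow> ('b, 'l) ring_scheme \<Rightarrow> ('b, ('a \<times> 'b \<Rightarrow>\<^sub>0 int) set) module"
  where "tensor_algebra A B = quot_algebra (pair_algebra A B) (tensor_kernel A B)"

definition pure_tensor ::
    "('a, 'k) ring_scheme \<Rightarrow> ('b, 'l) ring_scheme \<Rightarrow> 'a \<Rightarrow> 'b \<Rightarrow> ('a \<times> 'b \<Rightarrow>\<^sub>0 int) set"
  where "pure_tensor A B a b = tensor_kernel A B +>\<^bsub>pair_algebra A B\<^esub> frag_of (a, b)"


context
  fixes A :: "('a, 'k) ring_scheme" and B :: "('b, 'l) ring_scheme"
  assumes A: "ring A" and B: "cring B"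
begin

interpretation A: ring A by (rule A)
interpretation B: cring B by (rule B)

private abbreviation (input) "P \<equiv> pair_algebra A B"
private abbreviation (input) "K \<equiv> tensor_kernel A B"

private lemma carrier_P: "x \<in> carrier P \<longleftrightarrow> Poly_Mapping.keys x \<subseteq> carrier A \<times> carrier B"
  by (simp add: pair_algebra_def)

private lemma ops_P [simp]: "\<one>\<^bsub>P\<^esub> = frag_of (\<one>\<^bsub>A\<^esub>, \<one>\<^bsub>B\<^esub>)" "\<zero>\<^bsub>P\<^esub> = 0" "x \<oplus>\<^bsub>P\<^esub> y = x + y"
  by (simp_all add: pair_algebra_def)

private lemma frag_extend_fun_diff:
  fixes f g :: "'x \<Rightarrow> 'y \<Rightarrow>\<^sub>0 int"
  shows "frag_extend (\<lambda>i. f i - g i) x = frag_extend f x - frag_extend g x"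
proof -
  have "frag_cmul c (u - v) = frag_cmul c u - frag_cmul c v" for c and u v :: "'y \<Rightarrow>\<^sub>0 int"
    by (simp add: poly_mapping_eqI lookup_minus right_diff_distrib)
  then show ?thesis by (simp add: frag_extend_def sum_subtractf)
qed

private lemma mult_of [simp]:
  "frag_of (a, b) \<otimes>\<^bsub>P\<^esub> frag_of (a', b') = frag_of (a \<otimes>\<^bsub>A\<^esub> a', b \<otimes>\<^bsub>B\<^esub> b')"
  by (simp add: pair_algebra_def)

private lemma mult_0 [simp]: "0 \<otimes>\<^bsub>P\<^esub> y = 0" "y \<otimes>\<^bsub>P\<^esub> 0 = 0"
  by (auto simp: pair_algebra_def intro: frag_extend_eq_0)

private lemma mult_diff_left: "(x - y) \<otimes>\<^bsub>P\<^esub> z = x \<otimes>\<^bsub>P\<^esub> z - y \<otimes>\<^bsub>P\<^esub> z"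
  by (simp add: pair_algebra_def frag_extend_diff)

private lemma mult_diff_right: "z \<otimes>\<^bsub>P\<^esub> (x - y) = z \<otimes>\<^bsub>P\<^esub> x - z \<otimes>\<^bsub>P\<^esub> y"
  by (simp add: pair_algebra_def frag_extend_diff frag_extend_fun_diff case_prod_unfold)

private lemma mult_uminus: "(- x) \<otimes>\<^bsub>P\<^esub> y = - (x \<otimes>\<^bsub>P\<^esub> y)" "x \<otimes>\<^bsub>P\<^esub> (- y) = - (x \<otimes>\<^bsub>P\<^esub> y)"
  using mult_diff_left[of 0 x y] mult_diff_right[of x 0 y] by simp_all

private lemma mult_add: "(x + y) \<otimes>\<^bsub>P\<^esub> z = x \<otimes>\<^bsub>P\<^esub> z + y \<otimes>\<^bsub>P\<^esub> z" "z \<otimes>\<^bsub>P\<^esub> (x + y) = z \<otimes>\<^bsub>P\<^esub> x + z \<otimes>\<^bsub>P\<^esub> y"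
  using mult_diff_left[of x "- y" z] mult_diff_right[of z x "- y"] by (simp_all add: mult_uminus)

private lemma smult_of [simp]: "c \<odot>\<^bsub>P\<^esub> frag_of (a, b) = frag_of (a, c \<otimes>\<^bsub>B\<^esub> b)"
  by (simp add: pair_algebra_def)

private lemma smult_0 [simp]: "c \<odot>\<^bsub>P\<^esub> 0 = 0"
  by (simp add: pair_algebra_def)

private lemma smult_diff: "c \<odot>\<^bsub>P\<^esub> (x - y) = c \<odot>\<^bsub>P\<^esub> x - c \<odot>\<^bsub>P\<^esub> y"
  by (simp add: pair_algebra_def frag_extend_diff)

private lemma smult_add: "c \<odot>\<^bsub>P\<^esub> (x + y) = c \<odot>\<^bsub>P\<^esub> x + c \<odot>\<^bsub>P\<^esub> y"
  by (simp add: pair_algebra_def frag_extend_add)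

private lemma zero_P: "0 \<in> carrier P"
  by (simp add: carrier_P)

private lemma diff_P: "x \<in> carrier P \<Longrightarrow> y \<in> carrier P \<Longrightarrow> x - y \<in> carrier P"
  using keys_diff[of x y] by (auto simp: carrier_P)

private lemma uminus_P: "x \<in> carrier P \<Longrightarrow> - x \<in> carrier P"
  by (simp add: carrier_P)

private lemma add_P: "x \<in> carrier P \<Longrightarrow> y \<in> carrier P \<Longrightarrow> x + y \<in> carrier P"
  using diff_P[of x "- y"] by (simp add: uminus_P)

private lemma of_P [simp]: "frag_of (a, b) \<in> carrier P \<longleftrightarrow> a \<in> carrier A \<and> b \<in> carrier B"
  by (simp add: carrier_P)

private lemma P_induct [consumes 1, case_names zero one diff]:
  assumes "x \<in> carrier P" and "Q 0"
    and "\<And>a b. \<lbrakk>a \<in> carrier A; b \<in> carrier B\<rbrakk> \<Longrightarrow> Q (frag_of (a, b))"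
    and "\<And>x y. \<lbrakk>Q x; Q y\<rbrakk> \<Longrightarrow> Q (x - y)"
  shows "Q x"
  by (rule frag_induction[of x "carrier A \<times> carrier B"]) (use assms in \<open>auto simp: carrier_P\<close>)

private lemma mult_P: "x \<in> carrier P \<Longrightarrow> y \<in> carrier P \<Longrightarrow> x \<otimes>\<^bsub>P\<^esub> y \<in> carrier P"
proof (induction rule: P_induct)
  case (one a b)
  from one(3) show ?case
    by (induction rule: P_induct) (use one(1,2) in \<open>auto simp: zero_P mult_diff_right diff_P\<close>)
qed (simp_all add: zero_P mult_diff_left diff_P)

private lemma smult_P: "c \<in> carrier B \<Longrightarrow> x \<in> carrier P \<Longrightarrow> c \<odot>\<^bsub>P\<^esub> x \<in> carrier P"
  by (erule P_induct) (simp_all add: zero_P smult_diff diff_P)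

private lemma assoc_P:
  assumes "x \<in> carrier P" "y \<in> carrier P" "z \<in> carrier P"
  shows "x \<otimes>\<^bsub>P\<^esub> y \<otimes>\<^bsub>P\<^esub> z = x \<otimes>\<^bsub>P\<^esub> (y \<otimes>\<^bsub>P\<^esub> z)"
  using assms
proof (induction rule: P_induct)
  case (one a b)
  note ab = this
  from ab(3) show ?case
  proof (induction rule: P_induct)
    case (one a' b')
    from ab(4) show ?case
      by (induction rule: P_induct)
        (use ab(1,2) one in \<open>auto simp: mult_diff_right A.m_assoc B.m_assoc\<close>)
  qed (simp_all add: mult_diff_left mult_diff_right)
qed (simp_all add: mult_diff_left)

private lemma ring_P: "ring P"
proof (rule ringI)
  show "abelian_group P"
    by (rule abelian_groupI)
      (auto simp: zero_P add_P algebra_simps intro!: bexI[OF _ uminus_P])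
  show "Group.monoid P"
  proof (rule monoidI)
    show "\<one>\<^bsub>P\<^esub> \<otimes>\<^bsub>P\<^esub> x = x" if "x \<in> carrier P" for x
      using that by (induction rule: P_induct) (simp_all add: mult_diff_right)
    show "x \<otimes>\<^bsub>P\<^esub> \<one>\<^bsub>P\<^esub> = x" if "x \<in> carrier P" for x
      using that by (induction rule: P_induct) (simp_all add: mult_diff_left)
  qed (auto simp: mult_P assoc_P)
qed (simp_all add: mult_add)

private lemma relators_P: "bilinearity_relators A B \<subseteq> carrier P"
  by (auto elim!: bilinearity_relators.cases intro!: diff_P)

private lemma subgroup_K: "additive_subgroup K P"
proof -
  interpret P: ring P by (rule ring_P)
  show ?thesis
    unfolding tensor_kernel_def by (intro additive_subgroupI P.add.generate_is_subgroup) (use relators_P in simp)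
qed

private lemma K_P: "x \<in> K \<Longrightarrow> x \<in> carrier P"
  using additive_subgroup.a_subset[OF subgroup_K] by auto

private lemma K_zero: "0 \<in> K"
  using additive_subgroup.zero_closed[OF subgroup_K] by simp

private lemma K_add: "x \<in> K \<Longrightarrow> y \<in> K \<Longrightarrow> x + y \<in> K"
  using additive_subgroup.a_closed[OF subgroup_K] by simp

private lemma inv_P: "x \<in> carrier P \<Longrightarrow> inv\<^bsub>add_monoid P\<^esub> x = - x"
  using abelian_group.minus_equality[OF ring.is_abelian_group[OF ring_P], of "- x" x]
  by (simp add: a_inv_def uminus_P)

private lemma K_uminus: "x \<in> K \<Longrightarrow> - x \<in> K"
  using subgroup.m_inv_closed[OF additive_subgroup.a_subgroup[OF subgroup_K], of x]
  by (simp only: inv_P K_P)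

private lemma K_diff: "x \<in> K \<Longrightarrow> y \<in> K \<Longrightarrow> x - y \<in> K"
  using K_add[of x "- y"] by (simp add: K_uminus)

private lemma K_relator: "x \<in> bilinearity_relators A B \<Longrightarrow> x \<in> K"
  unfolding tensor_kernel_def by (rule generate.incl)

private lemma K_induct [consumes 1, case_names zero rel uminus add]:
  assumes "x \<in> K" and "Q 0"
    and "\<And>x. x \<in> bilinearity_relators A B \<Longrightarrow> Q x"
    and "\<And>x. Q x \<Longrightarrow> Q (- x)"
    and "\<And>x y. \<lbrakk>Q x; Q y\<rbrakk> \<Longrightarrow> Q (x + y)"
  shows "Q x"
  using assms(1) unfolding tensor_kernel_def
proof (induction rule: generate.induct)
  case (inv h)
  then have "h \<in> carrier P" using relators_P by auto
  then show ?case using assms(3,4) inv by (simp only: inv_P)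
qed (use assms in auto)

private lemma mult_K:
  assumes "x \<in> K" "y \<in> carrier P"
  shows "x \<otimes>\<^bsub>P\<^esub> y \<in> K" "y \<otimes>\<^bsub>P\<^esub> x \<in> K"
proof -
  have "x \<otimes>\<^bsub>P\<^esub> y \<in> K \<and> y \<otimes>\<^bsub>P\<^esub> x \<in> K"
    using assms(2)
  proof (induction rule: P_induct)
    case (one a b)
    from assms(1) show ?case
    proof (induction rule: K_induct)
      case (rel x)
      then show ?case
      proof (cases rule: bilinearity_relators.cases)
        case (left c c' d)
        then show ?thesis
          using one bilinearity_relators.left[of "a \<otimes>\<^bsub>A\<^esub> c" A "a \<otimes>\<^bsub>A\<^esub> c'" "b \<otimes>\<^bsub>B\<^esub> d" B]
            bilinearity_relators.left[of "c \<otimes>\<^bsub>A\<^esub> a" A "c' \<otimes>\<^bsub>A\<^esub> a" "d \<otimes>\<^bsub>B\<^esub> b" B]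
          by (auto simp: mult_diff_left mult_diff_right A.l_distr A.r_distr intro!: K_relator)
      next
        case (right c d d')
        then show ?thesis
          using one bilinearity_relators.right[of "a \<otimes>\<^bsub>A\<^esub> c" A "b \<otimes>\<^bsub>B\<^esub> d" B "b \<otimes>\<^bsub>B\<^esub> d'"]
            bilinearity_relators.right[of "c \<otimes>\<^bsub>A\<^esub> a" A "d \<otimes>\<^bsub>B\<^esub> b" B "d' \<otimes>\<^bsub>B\<^esub> b"]
          by (auto simp: mult_diff_left mult_diff_right B.l_distr B.r_distr intro!: K_relator)
      qed
    qed (auto simp: K_zero mult_uminus K_uminus mult_add K_add)
  qed (auto simp: K_zero mult_diff_left mult_diff_right K_diff)
  then show "x \<otimes>\<^bsub>P\<^esub> y \<in> K" "y \<otimes>\<^bsub>P\<^esub> x \<in> K" by auto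
qed

lemma ideal_tensor_kernel: "ideal (tensor_kernel A B) (pair_algebra A B)"
  by (intro ideal.intro ideal_axioms.intro subgroup_K ring_P mult_K)

private lemma smult_K:
  assumes "c \<in> carrier B" "x \<in> K"
  shows "c \<odot>\<^bsub>P\<^esub> x \<in> K"
proof -
  have "c \<odot>\<^bsub>P\<^esub> x = frag_of (\<one>\<^bsub>A\<^esub>, c) \<otimes>\<^bsub>P\<^esub> x" using K_P[OF assms(2)]
    by (induction rule: P_induct) (use assms(1) in \<open>auto simp: smult_diff mult_diff_right\<close>)
  then show ?thesis using assms mult_K(2) by simp
qed

lemma assoc_algebra_tensor_algebra: "assoc_algebra B (tensor_algebra A B)"
  unfolding tensor_algebra_def
proof (rule assoc_algebra_quot_algebraI)
  interpret I: ideal K P by (rule ideal_tensor_kernel)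
  fix c d x y assume c: "c \<in> carrier B" and d: "d \<in> carrier B"
    and x: "x \<in> carrier P" and y: "y \<in> carrier P"
  have "(c \<oplus>\<^bsub>B\<^esub> d) \<odot>\<^bsub>P\<^esub> x - (c \<odot>\<^bsub>P\<^esub> x + d \<odot>\<^bsub>P\<^esub> x) \<in> K"
    using x
  proof (induction rule: P_induct)
    case (one a b)
    then show ?case
      using c d bilinearity_relators.right[of a A "c \<otimes>\<^bsub>B\<^esub> b" B "d \<otimes>\<^bsub>B\<^esub> b"]
      by (auto simp: B.l_distr diff_diff_eq intro!: K_relator)
  next
    case (diff x y)
    from K_diff[OF this] show ?case by (simp add: smult_diff algebra_simps)
  qed (simp add: K_zero)
  then have "(c \<oplus>\<^bsub>B\<^esub> d) \<odot>\<^bsub>P\<^esub> x \<in> K +>\<^bsub>P\<^esub> (c \<odot>\<^bsub>P\<^esub> x \<oplus>\<^bsub>P\<^esub> d \<odot>\<^bsub>P\<^esub> x)"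
    by (force simp: a_r_coset_def')
  then show "K +>\<^bsub>P\<^esub> ((c \<oplus>\<^bsub>B\<^esub> d) \<odot>\<^bsub>P\<^esub> x) = K +>\<^bsub>P\<^esub> (c \<odot>\<^bsub>P\<^esub> x \<oplus>\<^bsub>P\<^esub> d \<odot>\<^bsub>P\<^esub> x)"
    using I.a_repr_independence' c d x smult_P add_P by (metis ops_P(3))
  show "(c \<otimes>\<^bsub>B\<^esub> d) \<odot>\<^bsub>P\<^esub> x = c \<odot>\<^bsub>P\<^esub> (d \<odot>\<^bsub>P\<^esub> x)"
    using x by (induction rule: P_induct) (use c d in \<open>auto simp: smult_diff B.m_assoc\<close>)
  show "(c \<odot>\<^bsub>P\<^esub> x) \<otimes>\<^bsub>P\<^esub> y = c \<odot>\<^bsub>P\<^esub> (x \<otimes>\<^bsub>P\<^esub> y)"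
    using x
  proof (induction rule: P_induct)
    case (one a b)
    from y show ?case
      by (induction rule: P_induct) (use one c in \<open>auto simp: smult_diff mult_diff_right B.m_assoc\<close>)
  qed (simp_all add: smult_diff mult_diff_left)
  show "x \<otimes>\<^bsub>P\<^esub> (c \<odot>\<^bsub>P\<^esub> y) = c \<odot>\<^bsub>P\<^esub> (x \<otimes>\<^bsub>P\<^esub> y)"
    using x
  proof (induction rule: P_induct)
    case (one a b)
    from y show ?case
      by (induction rule: P_induct) (use one c in \<open>auto simp: smult_diff mult_diff_right B.m_lcomm\<close>)
  qed (simp_all add: smult_diff mult_diff_left)
next
  fix x assume "x \<in> carrier P"
  then show "\<one>\<^bsub>B\<^esub> \<odot>\<^bsub>P\<^esub> x = x"
    by (induction rule: P_induct) (auto simp: smult_diff)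
qed (auto simp: B ideal_tensor_kernel smult_P smult_K smult_add)

end


section \<open>The algebras of the theorem\<close>

text \<open>\<open>\<int>[q, q\<^sup>-\<^sup>1]\<close> is the group algebra of the infinite cyclic group of powers of \<open>q\<close>.\<close>

type_synonym laurent = "int \<Rightarrow>\<^sub>0 int"

definition laurent_q :: laurent (\<open>\<q>\<close>)
  where "\<q> = Poly_Mapping.single 1 1"

abbreviation laurent_ring :: "laurent ring"
  where "laurent_ring \<equiv> type_ring"

datatype hecke_hopf_gen = S_gen nat | D_gen nat

definition hecke_hopf_gens :: "nat \<Rightarrow> hecke_hopf_gen set"
  where "hecke_hopf_gens n = S_gen ` {1..<n} \<union> D_gen ` {1..<n}"

abbreviation s_var :: "nat \<Rightarrow> (hecke_hopf_gen free_monoid \<Rightarrow>\<^sub>0 int)" (\<open>\<s>\<close>)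
  where "\<s> i \<equiv> gen (S_gen i)"

abbreviation D_var :: "nat \<Rightarrow> (hecke_hopf_gen free_monoid \<Rightarrow>\<^sub>0 int)" (\<open>\<D>\<close>)
  where "\<D> i \<equiv> gen (D_gen i)"

inductive hecke_hopf_rel ::
    "nat \<Rightarrow> (hecke_hopf_gen free_monoid \<Rightarrow>\<^sub>0 int) \<Rightarrow> (hecke_hopf_gen free_monoid \<Rightarrow>\<^sub>0 int) \<Rightarrow> bool"
  for n
  where
    ss: "i \<in> {1..<n} \<Longrightarrow> hecke_hopf_rel n ((\<s> i)\<^sup>2) 1"
  | sD: "i \<in> {1..<n} \<Longrightarrow> hecke_hopf_rel n (\<s> i * \<D> i + \<D> i * \<s> i) (\<s> i - 1)"
  | DD: "i \<in> {1..<n} \<Longrightarrow> hecke_hopf_rel n ((\<D> i)\<^sup>2) (\<D> i)"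
  | far_ss: "\<lbrakk>i \<in> {1..<n}; j \<in> {1..<n}; \<bar>int i - int j\<bar> > 1\<rbrakk> \<Longrightarrow>
      hecke_hopf_rel n (\<s> j * \<s> i) (\<s> i * \<s> j)"
  | far_Ds: "\<lbrakk>i \<in> {1..<n}; j \<in> {1..<n}; \<bar>int i - int j\<bar> > 1\<rbrakk> \<Longrightarrow>
      hecke_hopf_rel n (\<D> j * \<s> i) (\<s> i * \<D> j)"
  | far_DD: "\<lbrakk>i \<in> {1..<n}; j \<in> {1..<n}; \<bar>int i - int j\<bar> > 1\<rbrakk> \<Longrightarrow>
      hecke_hopf_rel n (\<D> j * \<D> i) (\<D> i * \<D> j)"
  | near_sss: "\<lbrakk>i \<in> {1..<n}; j \<in> {1..<n}; \<bar>int i - int j\<bar> = 1\<rbrakk> \<Longrightarrow>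
      hecke_hopf_rel n (\<s> j * \<s> i * \<s> j) (\<s> i * \<s> j * \<s> i)"
  | near_Dss: "\<lbrakk>i \<in> {1..<n}; j \<in> {1..<n}; \<bar>int i - int j\<bar> = 1\<rbrakk> \<Longrightarrow>
      hecke_hopf_rel n (\<D> i * \<s> j * \<s> i) (\<s> j * \<s> i * \<D> j)"
  | near_DsD: "\<lbrakk>i \<in> {1..<n}; j \<in> {1..<n}; \<bar>int i - int j\<bar> = 1\<rbrakk> \<Longrightarrow>
      hecke_hopf_rel n (\<D> j * \<s> i * \<D> j) (\<s> i * \<D> j * \<D> i + \<D> i * \<D> j * \<s> i + \<s> i * \<D> j * \<s> i)"

definition hecke_hopf ::
    "nat \<Rightarrow> (int, (hecke_hopf_gen free_monoid \<Rightarrow>\<^sub>0 int) set) module"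
  where "hecke_hopf n = presented_algebra (hecke_hopf_gens n) (hecke_hopf_rel n)"

definition hecke_hopf_s :: "nat \<Rightarrow> nat \<Rightarrow> (hecke_hopf_gen free_monoid \<Rightarrow>\<^sub>0 int) set"
  where "hecke_hopf_s n i = presented_gen (hecke_hopf_gens n) (hecke_hopf_rel n) (S_gen i)"

definition hecke_hopf_D :: "nat \<Rightarrow> nat \<Rightarrow> (hecke_hopf_gen free_monoid \<Rightarrow>\<^sub>0 int) set"
  where "hecke_hopf_D n i = presented_gen (hecke_hopf_gens n) (hecke_hopf_rel n) (D_gen i)"

inductive hecke_rel ::
    "nat \<Rightarrow> (nat free_monoid \<Rightarrow>\<^sub>0 laurent) \<Rightarrow> (nat free_monoid \<Rightarrow>\<^sub>0 laurent) \<Rightarrow> bool"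
  for n
  where
    braid: "\<lbrakk>i \<in> {1..<n}; j \<in> {1..<n}; \<bar>int i - int j\<bar> = 1\<rbrakk> \<Longrightarrow>
      hecke_rel n (gen i * gen j * gen i) (gen j * gen i * gen j)"
  | commute: "\<lbrakk>i \<in> {1..<n}; j \<in> {1..<n}; \<bar>int i - int j\<bar> > 1\<rbrakk> \<Longrightarrow>
      hecke_rel n (gen i * gen j) (gen j * gen i)"
  | quadratic: "i \<in> {1..<n} \<Longrightarrow>
      hecke_rel n ((gen i)\<^sup>2) (Poly_Mapping.single 0 (1 - \<q>) * gen i + Poly_Mapping.single 0 \<q>)"

definition hecke_algebra ::
    "nat \<Rightarrow> (laurent, (nat free_monoid \<Rightarrow>\<^sub>0 laurent) set) module"
  where "hecke_algebra n = presented_algebra {1..<n} (hecke_rel n)"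

definition hecke_T :: "nat \<Rightarrow> nat \<Rightarrow> (nat free_monoid \<Rightarrow>\<^sub>0 laurent) set"
  where "hecke_T n i = presented_gen {1..<n} (hecke_rel n) i"

definition hecke_hopf_laurent ::
    "nat \<Rightarrow> (laurent, ((hecke_hopf_gen free_monoid \<Rightarrow>\<^sub>0 int) set \<times> laurent \<Rightarrow>\<^sub>0 int) set) module"
  where "hecke_hopf_laurent n = tensor_algebra (hecke_hopf n) laurent_ring"

text \<open>The identification of \<open>x \<in> H(S\<^sub>n)\<close> with \<open>x \<otimes> 1\<close>.\<close>

definition hecke_hopf_embed ::
    "nat \<Rightarrow> (hecke_hopf_gen free_monoid \<Rightarrow>\<^sub>0 int) set
      \<Rightarrow> ((hecke_hopf_gen free_monoid \<Rightarrow>\<^sub>0 int) set \<times> laurent \<Rightarrow>\<^sub>0 int) set"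
  where "hecke_hopf_embed n x = pure_tensor (hecke_hopf n) laurent_ring x 1"

lemma assoc_algebra_hecke_algebra: "assoc_algebra laurent_ring (hecke_algebra n)"
  unfolding hecke_algebra_def
  by (rule assoc_algebra_presented_algebra)
    (auto elim!: hecke_rel.cases simp: power2_eq_square intro!: free_algebra_closed)

lemma assoc_algebra_hecke_hopf: "assoc_algebra type_ring (hecke_hopf n)"
  unfolding hecke_hopf_def
  by (rule assoc_algebra_presented_algebra)
    (auto elim!: hecke_hopf_rel.cases simp: power2_eq_square hecke_hopf_gens_def
      intro!: free_algebra_closed)

lemma assoc_algebra_hecke_hopf_laurent: "assoc_algebra laurent_ring (hecke_hopf_laurent n)"
  unfolding hecke_hopf_laurent_def
  by (intro assoc_algebra_tensor_algebra cring_type_ring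
      assoc_algebra.axioms(2)[OF assoc_algebra_hecke_hopf])

end

theory Submission
  imports Defs "HOL-Combinatorics.Perm" "HOL-Combinatorics.Permutations"
begin

text \<open>\<open>H(S\<^sub>n)\<close> acts on the functions \<open>u\<close> on permutations by
  \<open>(s\<^sub>i u) w = u (w s\<^sub>i)\<close> and \<open>D\<^sub>i = f\<^sub>i (1 - s\<^sub>i)\<close>, where \<open>f\<^sub>i\<close> is the indicator function of the
  permutations with a descent at \<open>i\<close>. Through \<open>\<phi>\<close> this becomes a rescaled regular representation of
  the Hecke algebra: for \<open>w\<close> in \<open>S\<^sub>n\<close>, sending the delta function at \<open>w\<close> to
  \<open>\<tau>\<^sub>w = q\<^sup>-\<^sup>l\<^sup>(\<^sup>w\<^sup>) T\<^sub>v\<close>, where \<open>v\<close> is the inverse of \<open>w\<close>, defines a linear map \<open>\<theta>\<close> into \<open>H\<^sub>q(S\<^sub>n)\<close> with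
  \<open>\<theta> (x u) = x \<theta> u\<close>. Hence \<open>x = \<theta> (x \<delta>\<^sub>1)\<close> is determined by the action of \<open>\<phi> x\<close>.\<close>

section \<open>Homomorphisms from quotient algebras\<close>

text \<open>The action rests on one property of the descent indicators: exactly one of
  \<open>w\<close> and \<open>w s_i\<close> has a descent at \<open>i\<close>, so
  \<open>f_i + s_i f_i = 1\<close>. On delta functions, \<open>s_i + (1 - q) D_i\<close> sends the
  one at \<open>w\<close> to \<open>q\<close> times the one at \<open>w s_i\<close> if
  \<open>w\<close> ascends at \<open>i\<close>, and otherwise to the one at \<open>w s_i\<close>
  plus \<open>1 - q\<close> times the one at \<open>w\<close>. In the usual regular representation
  the coefficients \<open>1\<close> and \<open>q\<close> at \<open>w s_i\<close> stand the other way
  round; the factor \<open>q^(-l(w))\<close> exchanges them, and passing to the inverse turns right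
  multiplication of \<open>w\<close> into left multiplication by \<open>T_i\<close>. The delicate
  point is \<open>T_v\<close>: in an algebra known only by generators and relations, such a product
  a priori depends on a word. One word is fixed for each permutation, and at every ascent the braid
  relations turn the product of \<open>T_i\<close> with the word of \<open>w\<close> into the word
  of \<open>w s_i\<close>. The functions live on all finitely supported permutations of the natural
  numbers, so the operators are the same for every \<open>n\<close>; the finite sum in
  \<open>\<theta>\<close> singles out \<open>S_n\<close>.\<close>

lemma alg_homI:
  assumes "\<And>x. x \<in> carrier A \<Longrightarrow> h x \<in> carrier B"
    and "\<And>x y. \<lbrakk>x \<in> carrier A; y \<in> carrier A\<rbrakk> \<Longrightarrow> h (x \<otimes>\<^bsub>A\<^esub> y) = h x \<otimes>\<^bsub>B\<^esub> h y"
    and "\<And>x y. \<lbrakk>x \<in> carrier A; y \<in> carrier A\<rbrakk> \<Longrightarrow> h (x \<oplus>\<^bsub>A\<^esub> y) = h x \<oplus>\<^bsub>B\<^esub> h y"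
    and "h \<one>\<^bsub>A\<^esub> = \<one>\<^bsub>B\<^esub>"
    and "\<And>c x. \<lbrakk>c \<in> carrier R; x \<in> carrier A\<rbrakk> \<Longrightarrow> h (c \<odot>\<^bsub>A\<^esub> x) = c \<odot>\<^bsub>B\<^esub> h x"
  shows "h \<in> alg_hom R A B"
  unfolding alg_hom_def using assms by (auto intro!: ring_hom_memI)

lemma alg_homD:
  assumes "h \<in> alg_hom R A B"
  shows "x \<in> carrier A \<Longrightarrow> h x \<in> carrier B"
    and "\<lbrakk>x \<in> carrier A; y \<in> carrier A\<rbrakk> \<Longrightarrow> h (x \<otimes>\<^bsub>A\<^esub> y) = h x \<otimes>\<^bsub>B\<^esub> h y"
    and "\<lbrakk>x \<in> carrier A; y \<in> carrier A\<rbrakk> \<Longrightarrow> h (x \<oplus>\<^bsub>A\<^esub> y) = h x \<oplus>\<^bsub>B\<^esub> h y"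
    and "h \<one>\<^bsub>A\<^esub> = \<one>\<^bsub>B\<^esub>"
    and "\<lbrakk>c \<in> carrier R; x \<in> carrier A\<rbrakk> \<Longrightarrow> h (c \<odot>\<^bsub>A\<^esub> x) = c \<odot>\<^bsub>B\<^esub> h x"
    and "h \<in> ring_hom A B"
  using assms by (auto simp: alg_hom_def ring_hom_closed ring_hom_mult ring_hom_add ring_hom_one)

lemma alg_hom_comp:
  assumes "f \<in> alg_hom R A B" "g \<in> alg_hom R B C"
  shows "(\<lambda>x. g (f x)) \<in> alg_hom R A C"
  using assms by (intro alg_homI) (simp_all add: alg_homD)

lemma carrier_quot_algebra:
  assumes "ideal I A"
  shows "X \<in> carrier (quot_algebra A I) \<longleftrightarrow> (\<exists>x\<in>carrier A. X = I +>\<^bsub>A\<^esub> x)"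
  by (auto simp: quot_algebra_def FactRing_def A_RCOSETS_def')

lemma quot_algebra_ops:
  fixes A (structure)
  assumes "ideal I A"
  shows "\<lbrakk>x \<in> carrier A; y \<in> carrier A\<rbrakk> \<Longrightarrow>
      (I +>\<^bsub>A\<^esub> x) \<otimes>\<^bsub>quot_algebra A I\<^esub> (I +>\<^bsub>A\<^esub> y) = I +>\<^bsub>A\<^esub> (x \<otimes>\<^bsub>A\<^esub> y)"
    and "\<lbrakk>x \<in> carrier A; y \<in> carrier A\<rbrakk> \<Longrightarrow>
      (I +>\<^bsub>A\<^esub> x) \<oplus>\<^bsub>quot_algebra A I\<^esub> (I +>\<^bsub>A\<^esub> y) = I +>\<^bsub>A\<^esub> (x \<oplus>\<^bsub>A\<^esub> y)"
    and "\<one>\<^bsub>quot_algebra A I\<^esub> = I +>\<^bsub>A\<^esub> \<one>\<^bsub>A\<^esub>"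
proof -
  interpret I: ideal I A by fact
  show "\<lbrakk>x \<in> carrier A; y \<in> carrier A\<rbrakk> \<Longrightarrow>
      (I +>\<^bsub>A\<^esub> x) \<otimes>\<^bsub>quot_algebra A I\<^esub> (I +>\<^bsub>A\<^esub> y) = I +>\<^bsub>A\<^esub> (x \<otimes>\<^bsub>A\<^esub> y)"
    by (simp add: quot_algebra_def FactRing_def I.rcoset_mult_add)
  show "\<lbrakk>x \<in> carrier A; y \<in> carrier A\<rbrakk> \<Longrightarrow>
      (I +>\<^bsub>A\<^esub> x) \<oplus>\<^bsub>quot_algebra A I\<^esub> (I +>\<^bsub>A\<^esub> y) = I +>\<^bsub>A\<^esub> (x \<oplus>\<^bsub>A\<^esub> y)"
    by (simp add: quot_algebra_def FactRing_def I.a_rcos_sum)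
qed (simp add: quot_algebra_def FactRing_def)

text \<open>A scalar that acts as left multiplication by an element \<open>e\<close> acts on cosets
  as multiplication by the coset of \<open>e\<close>, which is well defined for an ideal. This form
  of the hypothesis serves both \<open>free_algebra\<close>, where \<open>e\<close> is a constant
  polynomial, and \<open>pair_algebra\<close>, where \<open>e\<close> is
  \<open>frag_of (1, c)\<close>; in the latter the action is not additive in the scalar before the
  quotient is taken.\<close>

lemma quot_algebra_smult:
  fixes A (structure)
  assumes I: "ideal I A" and x: "x \<in> carrier A" and e: "e \<in> carrier A"
    and smult: "\<And>y. y \<in> carrier A \<Longrightarrow> c \<odot>\<^bsub>A\<^esub> y = e \<otimes>\<^bsub>A\<^esub> y"
  shows "c \<odot>\<^bsub>quot_algebra A I\<^esub> (I +>\<^bsub>A\<^esub> x) = I +>\<^bsub>A\<^esub> (c \<odot>\<^bsub>A\<^esub> x)"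
proof -
  interpret I: ideal I A by fact
  have "I +>\<^bsub>A\<^esub> (c \<odot>\<^bsub>A\<^esub> y) = I +>\<^bsub>A\<^esub> (c \<odot>\<^bsub>A\<^esub> x)" if y: "y \<in> I +>\<^bsub>A\<^esub> x" for y
  proof -
    have yA: "y \<in> carrier A"
      using y x I.a_subset by (auto simp: a_r_coset_def')
    have "I +>\<^bsub>A\<^esub> (e \<otimes>\<^bsub>A\<^esub> y) = rcoset_mult A I (I +>\<^bsub>A\<^esub> e) (I +>\<^bsub>A\<^esub> y)"
      by (simp add: I.rcoset_mult_add e yA)
    also have "I +>\<^bsub>A\<^esub> y = I +>\<^bsub>A\<^esub> x"
      using I.a_repr_independence'[OF y x] by simp
    also have "rcoset_mult A I (I +>\<^bsub>A\<^esub> e) (I +>\<^bsub>A\<^esub> x) = I +>\<^bsub>A\<^esub> (e \<otimes>\<^bsub>A\<^esub> x)"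
      by (simp add: I.rcoset_mult_add e x)
    finally show ?thesis by (simp add: smult x yA)
  qed
  then have "(\<Union>y\<in>I +>\<^bsub>A\<^esub> x. I +>\<^bsub>A\<^esub> (c \<odot>\<^bsub>A\<^esub> y)) = (\<Union>y\<in>I +>\<^bsub>A\<^esub> x. I +>\<^bsub>A\<^esub> (c \<odot>\<^bsub>A\<^esub> x))"
    by (rule SUP_cong[OF refl])
  also have "\<dots> = I +>\<^bsub>A\<^esub> (c \<odot>\<^bsub>A\<^esub> x)"
    using I.a_rcos_self[OF x] by blast
  finally show ?thesis by (simp add: quot_algebra_def)
qed

lemma quot_algebra_proj:
  fixes A (structure)
  assumes I: "ideal I A"
    and scalar: "\<And>c. c \<in> carrier R \<Longrightarrow> \<exists>e\<in>carrier A. \<forall>y\<in>carrier A. c \<odot>\<^bsub>A\<^esub> y = e \<otimes>\<^bsub>A\<^esub> y"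
  shows "(+>\<^bsub>A\<^esub>) I \<in> alg_hom R A (quot_algebra A I)"
proof (rule alg_homI)
  fix c x assume "c \<in> carrier R" "x \<in> carrier A"
  then show "I +>\<^bsub>A\<^esub> (c \<odot>\<^bsub>A\<^esub> x) = c \<odot>\<^bsub>quot_algebra A I\<^esub> (I +>\<^bsub>A\<^esub> x)"
    using scalar[of c] quot_algebra_smult[OF I] by metis
qed (use I in \<open>auto simp: quot_algebra_ops carrier_quot_algebra\<close>)

lemma quot_algebra_hom:
  fixes A (structure)
  assumes I: "ideal I A" and B: "ring B" and h: "h \<in> alg_hom R A B"
    and kernel: "\<And>x. x \<in> I \<Longrightarrow> h x = \<zero>\<^bsub>B\<^esub>"
    and scalar: "\<And>c. c \<in> carrier R \<Longrightarrow> \<exists>e\<in>carrier A. \<forall>y\<in>carrier A. c \<odot>\<^bsub>A\<^esub> y = e \<otimes>\<^bsub>A\<^esub> y"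
  obtains \<phi> where "\<phi> \<in> alg_hom R (quot_algebra A I) B"
    and "\<And>x. x \<in> carrier A \<Longrightarrow> \<phi> (I +>\<^bsub>A\<^esub> x) = h x"
proof
  interpret I: ideal I A by fact
  interpret B: ring B by fact
  \<comment> \<open>Since \<open>h\<close> vanishes on \<open>I\<close>, it is constant on every
    coset, so the image of a coset is a singleton.\<close>
  let ?\<phi> = "\<lambda>X. the_elem (h ` X)"
  show \<phi>: "?\<phi> (I +>\<^bsub>A\<^esub> x) = h x" if x: "x \<in> carrier A" for x
  proof -
    have "h y = h x" if "y \<in> I +>\<^bsub>A\<^esub> x" for y
    proof -
      obtain k where "k \<in> I" "y = k \<oplus>\<^bsub>A\<^esub> x"
        using \<open>y \<in> _\<close> by (auto simp: a_r_coset_def')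
      moreover have "k \<in> carrier A" using \<open>k \<in> I\<close> I.a_subset by auto
      ultimately show ?thesis using x by (simp add: alg_homD[OF h] kernel)
    qed
    then have "h ` (I +>\<^bsub>A\<^esub> x) = {h x}"
      using I.a_rcos_self[OF x] by blast
    then show ?thesis by simp
  qed
  note proj = alg_homD[OF quot_algebra_proj[OF I scalar]]
  show "?\<phi> \<in> alg_hom R (quot_algebra A I) B"
  proof (rule alg_homI)
    fix c X assume c: "c \<in> carrier R" and "X \<in> carrier (quot_algebra A I)"
    then obtain x where x: "x \<in> carrier A" "X = I +>\<^bsub>A\<^esub> x"
      by (auto simp: carrier_quot_algebra[OF I])
    obtain e where "e \<in> carrier A" "\<forall>y\<in>carrier A. c \<odot>\<^bsub>A\<^esub> y = e \<otimes>\<^bsub>A\<^esub> y"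
      using scalar[OF c] by blast
    then have "c \<odot>\<^bsub>A\<^esub> x \<in> carrier A" using x by simp
    then show "?\<phi> (c \<odot>\<^bsub>quot_algebra A I\<^esub> X) = c \<odot>\<^bsub>B\<^esub> ?\<phi> X"
      using c x by (simp add: proj(5)[symmetric] \<phi> alg_homD[OF h])
  qed (auto simp: carrier_quot_algebra[OF I] quot_algebra_ops[OF I] \<phi> alg_homD[OF h])
qed

section \<open>Evaluation of noncommutative polynomials\<close>

text \<open>A monomial is a product of generators and a constant, and a polynomial is built up by
  adding monomials on words outside its current support; for such a word \<open>update\<close> is a
  sum.\<close>

lemma free_algebra_induct [consumes 1, case_names const gen add mult]:
  assumes p: "p \<in> carrier (free_algebra X)"
    and const: "\<And>c. P (Poly_Mapping.single 0 c)"
    and gen: "\<And>x. x \<in> X \<Longrightarrow> P (gen x)"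
    and add: "\<And>p q. \<lbrakk>p \<in> carrier (free_algebra X); q \<in> carrier (free_algebra X); P p; P q\<rbrakk> \<Longrightarrow> P (p + q)"
    and mult: "\<And>p q. \<lbrakk>p \<in> carrier (free_algebra X); q \<in> carrier (free_algebra X); P p; P q\<rbrakk> \<Longrightarrow> P (p * q)"
  shows "P p"
proof -
  have word: "P (Poly_Mapping.single (Word xs) c)" if "set xs \<subseteq> X" for xs c
    using that
  proof (induction xs arbitrary: c)
    case Nil
    then show ?case using const[of c] by (simp add: zero_free_monoid_def)
  next
    case (Cons x xs)
    have "Poly_Mapping.single (Word (x # xs)) c = gen x * Poly_Mapping.single (Word xs) c"
      by (simp add: gen_def mult_single plus_free_monoid_def)
    moreover have "Poly_Mapping.single (Word xs) c \<in> carrier (free_algebra X)"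
      using Cons.prems by (simp add: free_algebra_def)
    ultimately show ?case
      using mult[OF gen_closed _ gen] Cons by simp
  qed
  show ?thesis
    using p
  proof (induction p rule: update_induct)
    case const
    then show ?case using assms(2)[of 0] by simp
  next
    case (update f w c)
    have eq: "Poly_Mapping.update w c f = Poly_Mapping.single w c + f"
      using update.hyps
      by (intro poly_mapping_eqI) (auto simp: lookup_update lookup_add lookup_single in_keys_iff when_def)
    have "Poly_Mapping.keys (Poly_Mapping.update w c f) = insert w (Poly_Mapping.keys f)"
      using update.hyps by (auto simp: in_keys_iff lookup_update split: if_splits)
    then have w: "set (letters w) \<subseteq> X" and f: "f \<in> carrier (free_algebra X)"
      using update.prems by (auto simp: free_algebra_def)
    have "Poly_Mapping.single w c \<in> carrier (free_algebra X)"
      using w by (simp add: free_algebra_def)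
    then show ?case
      unfolding eq using word[OF w, of c] f update.IH add by simp
  qed
qed

lemma free_algebra_ops:
  "p \<otimes>\<^bsub>free_algebra X\<^esub> q = p * q" "p \<oplus>\<^bsub>free_algebra X\<^esub> q = p + q"
  "\<one>\<^bsub>free_algebra X\<^esub> = 1" "\<zero>\<^bsub>free_algebra X\<^esub> = 0"
  "c \<odot>\<^bsub>free_algebra X\<^esub> p = Poly_Mapping.single 0 c * p"
  by (simp_all add: free_algebra_def)

lemma free_algebra_UNIV [simp]: "p \<in> carrier (free_algebra UNIV)"
  by (simp add: free_algebra_def)

definition word_eval :: "('b, 'm) monoid_scheme \<Rightarrow> ('x \<Rightarrow> 'b) \<Rightarrow> 'x list \<Rightarrow> 'b"
  where "word_eval B g xs = foldr (\<lambda>x y. g x \<otimes>\<^bsub>B\<^esub> y) xs \<one>\<^bsub>B\<^esub>"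

lemma word_eval_simps [simp]:
  "word_eval B g [] = \<one>\<^bsub>B\<^esub>" "word_eval B g (x # xs) = g x \<otimes>\<^bsub>B\<^esub> word_eval B g xs"
  by (simp_all add: word_eval_def)

lemma (in Group.monoid) word_eval_closed:
  "g ` set xs \<subseteq> carrier G \<Longrightarrow> word_eval G g xs \<in> carrier G"
  by (induction xs) auto

lemma (in Group.monoid) word_eval_append:
  assumes "g ` set xs \<subseteq> carrier G" "g ` set ys \<subseteq> carrier G"
  shows "word_eval G g (xs @ ys) = word_eval G g xs \<otimes> word_eval G g ys"
  using assms by (induction xs) (auto simp: m_assoc word_eval_closed)

definition free_eval ::
    "('r::comm_ring_1, 'b, 'm) module_scheme \<Rightarrow> ('x \<Rightarrow> 'b) \<Rightarrow> ('x free_monoid \<Rightarrow>\<^sub>0 'r) \<Rightarrow> 'b"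
  where "free_eval B g p =
    (\<Oplus>\<^bsub>B\<^esub>w\<in>Poly_Mapping.keys p. Poly_Mapping.lookup p w \<odot>\<^bsub>B\<^esub> word_eval B g (letters w))"

lemma type_ring_simps [simp]:
  "c \<in> carrier type_ring" "\<zero>\<^bsub>type_ring\<^esub> = (0 :: 'r::comm_ring_1)" "\<one>\<^bsub>type_ring\<^esub> = (1 :: 'r)"
  "c \<oplus>\<^bsub>type_ring\<^esub> d = (c + d :: 'r)" "c \<otimes>\<^bsub>type_ring\<^esub> d = (c * d :: 'r)"
  by (simp_all add: type_ring_def)

context
  fixes B :: "('r::comm_ring_1, 'b, 'm) module_scheme" (structure) and g :: "'x \<Rightarrow> 'b" and X
  assumes B: "assoc_algebra type_ring B" and g: "\<And>x. x \<in> X \<Longrightarrow> g x \<in> carrier B"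
begin

interpretation B: assoc_algebra type_ring B by (rule B)

private lemma smult_commute: "x \<in> carrier B \<Longrightarrow> c \<odot> (d \<odot> x) = d \<odot> (c \<odot> x)"
  using B.smult_assoc1[unfolded type_ring_simps, of c d x] B.smult_assoc1[unfolded type_ring_simps, of d c x]
  by (simp add: mult.commute)

private lemma word_closed: "set xs \<subseteq> X \<Longrightarrow> word_eval B g xs \<in> carrier B"
  using g by (intro B.word_eval_closed) auto

text \<open>Cancellation can make the support of \<open>p + q\<close> smaller than the union of the
  supports of \<open>p\<close> and \<open>q\<close>. Over a common larger set of words the
  evaluation becomes visibly additive.\<close>

private lemma free_eval_superset:
  assumes "p \<in> carrier (free_algebra X)" "finite W" "Poly_Mapping.keys p \<subseteq> W"
    "\<And>w. w \<in> W \<Longrightarrow> set (letters w) \<subseteq> X"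
  shows "free_eval B g p = (\<Oplus>w\<in>W. Poly_Mapping.lookup p w \<odot> word_eval B g (letters w))"
  unfolding free_eval_def
proof (rule B.add.finprod_mono_neutral_cong_left)
  show "Poly_Mapping.lookup p w \<odot> word_eval B g (letters w) = \<zero>" if "w \<in> W - Poly_Mapping.keys p" for w
    using that word_closed assms(4) B.smult_l_null by (auto simp: in_keys_iff)
qed (use assms word_closed in auto)

lemma free_eval_closed:
  assumes "p \<in> carrier (free_algebra X)"
  shows "free_eval B g p \<in> carrier B"
  unfolding free_eval_def using assms word_closed
  by (intro B.finsum_closed) (auto simp: free_algebra_def)

lemma free_eval_single:
  assumes "set (letters w) \<subseteq> X"
  shows "free_eval B g (Poly_Mapping.single w c) = c \<odot> word_eval B g (letters w)"
  using free_eval_superset[of "Poly_Mapping.single w c" "{w}"] assms word_closed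
  by (simp add: free_algebra_def)

lemma free_eval_add:
  assumes "p \<in> carrier (free_algebra X)" "q \<in> carrier (free_algebra X)"
  shows "free_eval B g (p + q) = free_eval B g p \<oplus> free_eval B g q"
proof -
  let ?W = "Poly_Mapping.keys p \<union> Poly_Mapping.keys q"
  have W: "set (letters w) \<subseteq> X" if "w \<in> ?W" for w
    using assms that by (auto simp: free_algebra_def)
  have "free_eval B g r = (\<Oplus>w\<in>?W. Poly_Mapping.lookup r w \<odot> word_eval B g (letters w))"
    if "r \<in> carrier (free_algebra X)" "Poly_Mapping.keys r \<subseteq> ?W" for r
    by (rule free_eval_superset) (use that W in auto)
  moreover have "(\<Oplus>w\<in>?W. Poly_Mapping.lookup (p + q) w \<odot> word_eval B g (letters w)) =
      (\<Oplus>w\<in>?W. Poly_Mapping.lookup p w \<odot> word_eval B g (letters w)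
         \<oplus> Poly_Mapping.lookup q w \<odot> word_eval B g (letters w))"
    by (intro B.finsum_cong')
      (use W word_closed in \<open>auto simp: lookup_add B.smult_l_distr[unfolded type_ring_simps]\<close>)
  moreover have "\<dots> = (\<Oplus>w\<in>?W. Poly_Mapping.lookup p w \<odot> word_eval B g (letters w))
      \<oplus> (\<Oplus>w\<in>?W. Poly_Mapping.lookup q w \<odot> word_eval B g (letters w))"
    by (rule B.finsum_addf) (use W word_closed in auto)
  ultimately show ?thesis
    using assms free_algebra_add_closed[OF assms] keys_add[of p q] by simp
qed

lemma free_eval_const: "free_eval B g (Poly_Mapping.single 0 c) = c \<odot> \<one>"
  using free_eval_single[of 0 c] by (simp add: zero_free_monoid_def)

lemma free_eval_gen: "x \<in> X \<Longrightarrow> free_eval B g (gen x) = g x"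
  using free_eval_single[of "Word [x]" 1] g B.smult_one[unfolded type_ring_simps] by (simp add: gen_def)

text \<open>Concatenation of words becomes multiplication in \<open>B\<close>, and the coefficients
  can be pulled out by bilinearity. With the empty word and the one-letter words this supplies the
  two base cases of multiplicativity.\<close>

private lemma free_eval_single_mult:
  assumes xs: "set xs \<subseteq> X" and q: "q \<in> carrier (free_algebra X)"
  shows "free_eval B g (Poly_Mapping.single (Word xs) c * q)
    = c \<odot> word_eval B g xs \<otimes> free_eval B g q"
proof -
  have "\<forall>w\<in>Poly_Mapping.keys q. set (letters w) \<subseteq> X"
    using q by (simp add: free_algebra_def)
  then show ?thesis
  proof (induction q rule: update_induct)
    case const
    have "free_eval B g 0 = \<zero>" by (simp add: free_eval_def)
    then show ?case using xs word_closed by simp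
  next
    case (update f w d)
    have eq: "Poly_Mapping.update w d f = Poly_Mapping.single w d + f"
      using update.hyps
      by (intro poly_mapping_eqI) (auto simp: lookup_update lookup_add lookup_single in_keys_iff when_def)
    have "Poly_Mapping.keys (Poly_Mapping.update w d f) = insert w (Poly_Mapping.keys f)"
      using update.hyps by (auto simp: in_keys_iff lookup_update split: if_splits)
    then have w: "set (letters w) \<subseteq> X" and f: "f \<in> carrier (free_algebra X)"
      using update.prems by (auto simp: free_algebra_def)
    have s: "Poly_Mapping.single u b \<in> carrier (free_algebra X)" if "set (letters u) \<subseteq> X" for u b
      using that by (simp add: free_algebra_def)
    have app: "word_eval B g (xs @ letters w) = word_eval B g xs \<otimes> word_eval B g (letters w)"
      by (rule B.word_eval_append) (use xs w g in auto)
    have "Poly_Mapping.single (Word xs) c * Poly_Mapping.update w d f =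
        Poly_Mapping.single (Word (xs @ letters w)) (c * d) + Poly_Mapping.single (Word xs) c * f"
      by (simp add: eq distrib_left mult_single plus_free_monoid_def)
    also have "free_eval B g \<dots> = (c * d) \<odot> word_eval B g (xs @ letters w)
        \<oplus> c \<odot> word_eval B g xs \<otimes> free_eval B g f"
      using xs w f update.IH[OF f[unfolded free_algebra_def, simplified]]
      by (simp add: free_eval_add free_eval_single free_algebra_mult_closed s)
    also have "\<dots> = c \<odot> word_eval B g xs \<otimes> (d \<odot> word_eval B g (letters w) \<oplus> free_eval B g f)"
      using xs w f by (simp add: app word_closed free_eval_closed B.r_distr B.smult_mult_left
          B.smult_mult_right B.smult_assoc1[unfolded type_ring_simps] smult_commute)
    also have "\<dots> = c \<odot> word_eval B g xs \<otimes> free_eval B g (Poly_Mapping.update w d f)"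
      using w f by (simp add: eq free_eval_add[OF s] free_eval_single)
    finally show ?case .
  qed
qed

lemma free_eval_mult:
  assumes p: "p \<in> carrier (free_algebra X)" and q: "q \<in> carrier (free_algebra X)"
  shows "free_eval B g (p * q) = free_eval B g p \<otimes> free_eval B g q"
  using p q
proof (induction p arbitrary: q rule: free_algebra_induct)
  case (const c)
  then show ?case
    using free_eval_single_mult[of "[]" q c] free_eval_const[of c] by (simp add: zero_free_monoid_def)
next
  case (gen x)
  then show ?case
    using free_eval_single_mult[of "[x]" q 1] g B.smult_one[unfolded type_ring_simps]
    by (simp add: gen_def[symmetric] free_eval_gen)
next
  case (add p p')
  then show ?case
    by (simp add: distrib_right free_eval_add free_algebra_mult_closed free_eval_closed B.l_distr)
next
  case (mult p p')
  then show ?case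
    by (simp add: mult.assoc free_algebra_mult_closed free_eval_closed B.m_assoc)
qed

lemma free_eval_alg_hom: "free_eval B g \<in> alg_hom type_ring (free_algebra X) B"
proof (rule alg_homI)
  have one: "free_eval B g 1 = \<one>"
    using free_eval_const[of 1] B.smult_one[unfolded type_ring_simps] by simp
  then show "free_eval B g \<one>\<^bsub>free_algebra X\<^esub> = \<one>"
    by (simp add: free_algebra_ops)
  fix c and p :: "'x free_monoid \<Rightarrow>\<^sub>0 'r" assume "p \<in> carrier (free_algebra X)"
  then show "free_eval B g (c \<odot>\<^bsub>free_algebra X\<^esub> p) = c \<odot> free_eval B g p"
    by (simp add: free_algebra_ops free_eval_mult free_algebra_const_closed free_eval_const
        B.smult_mult_left free_eval_closed)
qed (simp_all add: free_algebra_ops free_eval_closed free_eval_add free_eval_mult)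

lemma free_eval_zero: "free_eval B g 0 = \<zero>"
  by (simp add: free_eval_def)

lemma free_eval_uminus:
  assumes "p \<in> carrier (free_algebra X)"
  shows "free_eval B g (- p) = \<ominus> free_eval B g p"
proof -
  have "free_eval B g (- p) \<oplus> free_eval B g p = \<zero>"
    using free_eval_add[OF free_algebra_uminus_closed[OF assms] assms] by (simp add: free_eval_zero)
  then show ?thesis
    using assms by (simp add: B.minus_equality free_eval_closed free_algebra_uminus_closed)
qed

lemma free_eval_diff:
  assumes "p \<in> carrier (free_algebra X)" "q \<in> carrier (free_algebra X)"
  shows "free_eval B g (p - q) = free_eval B g p \<ominus> free_eval B g q"
  using free_eval_add[of p "- q"] assms free_algebra_uminus_closed[of q X]
  by (simp add: free_eval_uminus B.minus_eq)

end

section \<open>The universal property of an algebra given by generators and relations\<close>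

context
  fixes X :: "'x set"
    and rel :: "('x free_monoid \<Rightarrow>\<^sub>0 'r::comm_ring_1) \<Rightarrow> ('x free_monoid \<Rightarrow>\<^sub>0 'r) \<Rightarrow> bool"
  assumes rel_closed: "\<And>l r. rel l r \<Longrightarrow> l \<in> carrier (free_algebra X) \<and> r \<in> carrier (free_algebra X)"
begin

interpretation F: assoc_algebra type_ring "free_algebra X :: ('r, 'x free_monoid \<Rightarrow>\<^sub>0 'r) module"
  by (rule assoc_algebra_free_algebra)

private abbreviation (input) "I \<equiv> relations_ideal X rel"

private lemma relators_closed: "{l - r | l r. rel l r} \<subseteq> carrier (free_algebra X)"
  using rel_closed free_algebra_diff_closed by blast

lemma ideal_relations_ideal: "ideal (relations_ideal X rel) (free_algebra X)"
  unfolding relations_ideal_def by (rule F.genideal_ideal[OF relators_closed])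

private lemma scalar:
  "\<exists>e\<in>carrier (free_algebra X). \<forall>y\<in>carrier (free_algebra X).
     c \<odot>\<^bsub>free_algebra X\<^esub> y = e \<otimes>\<^bsub>free_algebra X\<^esub> (y :: 'x free_monoid \<Rightarrow>\<^sub>0 'r)"
  by (rule bexI[of _ "Poly_Mapping.single 0 c"]) (auto simp: free_algebra_ops free_algebra_const_closed)

lemma presented_algebra_proj:
  "(+>\<^bsub>free_algebra X\<^esub>) (relations_ideal X rel) \<in> alg_hom type_ring (free_algebra X) (presented_algebra X rel)"
  unfolding presented_algebra_def by (rule quot_algebra_proj[OF ideal_relations_ideal scalar])

lemma presented_gen_closed: "x \<in> X \<Longrightarrow> presented_gen X rel x \<in> carrier (presented_algebra X rel)"
  unfolding presented_gen_def by (rule alg_homD(1)[OF presented_algebra_proj gen_closed])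

lemma presented_algebra_relation:
  assumes "rel l r"
  shows "relations_ideal X rel +>\<^bsub>free_algebra X\<^esub> l = relations_ideal X rel +>\<^bsub>free_algebra X\<^esub> r"
proof -
  interpret I: ideal I "free_algebra X" by (rule ideal_relations_ideal)
  have "l - r \<in> I"
    unfolding relations_ideal_def by (rule subsetD[OF F.genideal_self[OF relators_closed]]) (use assms in blast)
  then have "l \<in> I +>\<^bsub>free_algebra X\<^esub> r"
    by (force simp: a_r_coset_def' free_algebra_ops)
  then show ?thesis
    using I.a_repr_independence' rel_closed[OF assms] by metis
qed

lemma presented_algebra_induct [consumes 1, case_names const gen add mult]:
  assumes x: "x \<in> carrier (presented_algebra X rel)"
    and const: "\<And>c. P (c \<odot>\<^bsub>presented_algebra X rel\<^esub> \<one>\<^bsub>presented_algebra X rel\<^esub>)"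
    and gen: "\<And>x. x \<in> X \<Longrightarrow> P (presented_gen X rel x)"
    and add: "\<And>x y. \<lbrakk>x \<in> carrier (presented_algebra X rel); y \<in> carrier (presented_algebra X rel); P x; P y\<rbrakk>
      \<Longrightarrow> P (x \<oplus>\<^bsub>presented_algebra X rel\<^esub> y)"
    and mult: "\<And>x y. \<lbrakk>x \<in> carrier (presented_algebra X rel); y \<in> carrier (presented_algebra X rel); P x; P y\<rbrakk>
      \<Longrightarrow> P (x \<otimes>\<^bsub>presented_algebra X rel\<^esub> y)"
  shows "P x"
proof -
  note proj = alg_homD[OF presented_algebra_proj]
  have "P (I +>\<^bsub>free_algebra X\<^esub> p)" if "p \<in> carrier (free_algebra X)" for p
    using that
  proof (induction p rule: free_algebra_induct)
    case (const c)
    show ?case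
      using assms(2)[of c] proj(5)[of c 1] proj(4)
      by (simp add: free_algebra_ops free_algebra_one_closed)
  next
    case (gen x)
    then show ?case using assms(3) by (simp add: presented_gen_def)
  next
    case (add p q)
    then show ?case using assms(4)[of "I +>\<^bsub>free_algebra X\<^esub> p" "I +>\<^bsub>free_algebra X\<^esub> q"]
      by (simp add: proj(1) proj(3)[symmetric] free_algebra_ops)
  next
    case (mult p q)
    then show ?case using assms(5)[of "I +>\<^bsub>free_algebra X\<^esub> p" "I +>\<^bsub>free_algebra X\<^esub> q"]
      by (simp add: proj(1) proj(2)[symmetric] free_algebra_ops)
  qed
  moreover obtain p where "p \<in> carrier (free_algebra X)" "x = I +>\<^bsub>free_algebra X\<^esub> p"
    using x carrier_quot_algebra[OF ideal_relations_ideal, of x] by (auto simp: presented_algebra_def)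
  ultimately show ?thesis by simp
qed

text \<open>The kernel of the evaluation is an ideal containing every relator \<open>l - r\<close>,
  hence it contains the ideal they generate, and the evaluation factors through the
  quotient.\<close>

lemma presented_algebra_hom:
  assumes B: "assoc_algebra type_ring (B :: ('r, 'b, 'm) module_scheme)"
    and g: "\<And>x. x \<in> X \<Longrightarrow> g x \<in> carrier B"
    and rel: "\<And>l r. rel l r \<Longrightarrow> free_eval B g l = free_eval B g r"
  obtains \<phi> where "\<phi> \<in> alg_hom type_ring (presented_algebra X rel) B"
    and "\<And>x. x \<in> X \<Longrightarrow> \<phi> (presented_gen X rel x) = g x"
proof -
  interpret B: assoc_algebra type_ring B by (rule B)
  have hom: "free_eval B g \<in> alg_hom type_ring (free_algebra X) B"
    by (rule free_eval_alg_hom[OF B g])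
  interpret h: ring_hom_ring "free_algebra X" B "free_eval B g"
    by (rule ring_hom_ringI2[OF F.ring_axioms B.ring_axioms alg_homD(6)[OF hom]])
  have "I \<subseteq> a_kernel (free_algebra X) B (free_eval B g)"
    unfolding relations_ideal_def
  proof (rule F.genideal_minimal[OF h.kernel_is_ideal])
    show "{l - r | l r. rel l r} \<subseteq> a_kernel (free_algebra X) B (free_eval B g)"
    proof safe
      fix l r assume "rel l r"
      then have lr: "l \<in> carrier (free_algebra X)" "r \<in> carrier (free_algebra X)"
        using rel_closed by auto
      have "free_eval B g (l - r) = \<zero>\<^bsub>B\<^esub>"
        using free_eval_diff[OF B g lr] free_eval_closed[OF B g lr(2)] rel[OF \<open>rel l r\<close>]
        by (simp add: B.r_neg B.minus_eq)
      then show "l - r \<in> a_kernel (free_algebra X) B (free_eval B g)"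
        using free_algebra_diff_closed[OF lr] unfolding a_kernel_def' by simp
    qed
  qed
  then have kernel: "free_eval B g p = \<zero>\<^bsub>B\<^esub>" if "p \<in> I" for p
    using that unfolding a_kernel_def' by blast
  obtain \<phi> where \<phi>: "\<phi> \<in> alg_hom type_ring (quot_algebra (free_algebra X) I) B"
    and coset: "\<And>p. p \<in> carrier (free_algebra X) \<Longrightarrow> \<phi> (I +>\<^bsub>free_algebra X\<^esub> p) = free_eval B g p"
    using quot_algebra_hom[OF ideal_relations_ideal B.ring_axioms hom kernel scalar] by blast
  show thesis
  proof (rule that[of \<phi>])
    show "\<phi> \<in> alg_hom type_ring (presented_algebra X rel) B"
      unfolding presented_algebra_def by (rule \<phi>)
    show "\<phi> (presented_gen X rel x) = g x" if "x \<in> X" for x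
      unfolding presented_gen_def coset[OF gen_closed[OF that]] by (rule free_eval_gen[OF B g that])
  qed
qed

lemma presented_algebra_hom_unique:
  assumes "\<phi> \<in> alg_hom type_ring (presented_algebra X rel) B"
    and "\<psi> \<in> alg_hom type_ring (presented_algebra X rel) B"
    and eq: "\<And>x. x \<in> X \<Longrightarrow> \<phi> (presented_gen X rel x) = \<psi> (presented_gen X rel x)"
    and x: "x \<in> carrier (presented_algebra X rel)"
  shows "\<phi> x = \<psi> x"
proof -
  interpret P: assoc_algebra type_ring "presented_algebra X rel"
    by (rule assoc_algebra_presented_algebra[OF rel_closed])
  show ?thesis
    using x by (induction rule: presented_algebra_induct)
      (simp_all add: alg_homD[OF assms(1)] alg_homD[OF assms(2)] eq)
qed

end

section \<open>The universal property of the tensor product\<close>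

context
  fixes A :: "('a, 'k) ring_scheme" and B :: "('b, 'l) ring_scheme"
  assumes A: "ring A" and B: "cring B"
begin

interpretation A: ring A by (rule A)
interpretation B: cring B by (rule B)

private abbreviation (input) "P \<equiv> pair_algebra A B"
private abbreviation (input) "K \<equiv> tensor_kernel A B"

interpretation K: ideal "tensor_kernel A B" "pair_algebra A B"
  by (rule ideal_tensor_kernel[OF A B])

private lemma carrier_P: "x \<in> carrier P \<longleftrightarrow> Poly_Mapping.keys x \<subseteq> carrier A \<times> carrier B"
  by (simp add: pair_algebra_def)

private lemma frag_of_closed: "a \<in> carrier A \<Longrightarrow> b \<in> carrier B \<Longrightarrow> frag_of (a, b) \<in> carrier P"
  by (simp add: carrier_P)

private lemma ops_P: "\<one>\<^bsub>P\<^esub> = frag_of (\<one>\<^bsub>A\<^esub>, \<one>\<^bsub>B\<^esub>)" "\<zero>\<^bsub>P\<^esub> = 0" "x \<oplus>\<^bsub>P\<^esub> y = x + y"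
  "frag_of (a, b) \<otimes>\<^bsub>P\<^esub> frag_of (a', b') = frag_of (a \<otimes>\<^bsub>A\<^esub> a', b \<otimes>\<^bsub>B\<^esub> b')"
  by (simp_all add: pair_algebra_def)

private lemma minus_P:
  assumes "x \<in> carrier P" "y \<in> carrier P"
  shows "x - y \<in> carrier P" "x - y = x \<oplus>\<^bsub>P\<^esub> \<ominus>\<^bsub>P\<^esub> y"
proof -
  have m: "- y \<in> carrier P" using assms(2) by (simp add: carrier_P)
  have "\<ominus>\<^bsub>P\<^esub> y = - y"
    by (rule K.minus_equality) (use assms m in \<open>auto simp: ops_P\<close>)
  then show "x - y = x \<oplus>\<^bsub>P\<^esub> \<ominus>\<^bsub>P\<^esub> y" by (simp add: ops_P)
  then show "x - y \<in> carrier P" using assms by simp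
qed

private lemma P_induct [consumes 1, case_names zero one add minus]:
  assumes "x \<in> carrier P" and "Q \<zero>\<^bsub>P\<^esub>"
    and one: "\<And>a b. \<lbrakk>a \<in> carrier A; b \<in> carrier B\<rbrakk> \<Longrightarrow> Q (frag_of (a, b))"
    and add: "\<And>x y. \<lbrakk>x \<in> carrier P; y \<in> carrier P; Q x; Q y\<rbrakk> \<Longrightarrow> Q (x \<oplus>\<^bsub>P\<^esub> y)"
    and minus: "\<And>x. \<lbrakk>x \<in> carrier P; Q x\<rbrakk> \<Longrightarrow> Q (\<ominus>\<^bsub>P\<^esub> x)"
  shows "Q x"
proof -
  have "x \<in> carrier P \<and> Q x"
  proof (rule frag_induction[of x "carrier A \<times> carrier B"])
    show "Poly_Mapping.keys x \<subseteq> carrier A \<times> carrier B" using assms(1) by (simp add: carrier_P)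
    show "0 \<in> carrier P \<and> Q 0" using assms(2) by (simp add: carrier_P ops_P)
    show "frag_of u \<in> carrier P \<and> Q (frag_of u)" if "u \<in> carrier A \<times> carrier B" for u
      using that one by (auto simp: frag_of_closed)
    show "u - v \<in> carrier P \<and> Q (u - v)" if "u \<in> carrier P \<and> Q u" "v \<in> carrier P \<and> Q v" for u v
      using that by (simp add: minus_P add minus)
  qed
  then show ?thesis ..
qed

private lemma smult_P:
  assumes "x \<in> carrier P"
  shows "c \<odot>\<^bsub>P\<^esub> x = frag_of (\<one>\<^bsub>A\<^esub>, c) \<otimes>\<^bsub>P\<^esub> x"
  using assms
  by (auto simp: carrier_P pair_algebra_def frag_extend_def intro!: sum.cong)

private lemma pair_scalar:
  "c \<in> carrier B \<Longrightarrow> \<exists>e\<in>carrier P. \<forall>y\<in>carrier P. c \<odot>\<^bsub>P\<^esub> y = e \<otimes>\<^bsub>P\<^esub> y"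
  by (rule bexI[of _ "frag_of (\<one>\<^bsub>A\<^esub>, c)"]) (auto simp: smult_P frag_of_closed)

private lemma pair_proj: "(+>\<^bsub>P\<^esub>) K \<in> alg_hom B P (tensor_algebra A B)"
  unfolding tensor_algebra_def by (rule quot_algebra_proj[OF K.ideal_axioms pair_scalar])

lemma pure_tensor_closed:
  "a \<in> carrier A \<Longrightarrow> b \<in> carrier B \<Longrightarrow> pure_tensor A B a b \<in> carrier (tensor_algebra A B)"
  unfolding pure_tensor_def by (rule alg_homD(1)[OF pair_proj frag_of_closed])

private lemma coset_eqI:
  assumes "x \<in> carrier P" "y \<in> carrier P" "x - y \<in> K"
  shows "K +>\<^bsub>P\<^esub> x = K +>\<^bsub>P\<^esub> y"
proof -
  have "x \<in> K +>\<^bsub>P\<^esub> y"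
    using assms(3) by (force simp: a_r_coset_def' ops_P)
  then show ?thesis using K.a_repr_independence' assms(2) by metis
qed

lemma pure_tensor_add_left:
  assumes "a \<in> carrier A" "a' \<in> carrier A" "b \<in> carrier B"
  shows "pure_tensor A B (a \<oplus>\<^bsub>A\<^esub> a') b = pure_tensor A B a b \<oplus>\<^bsub>tensor_algebra A B\<^esub> pure_tensor A B a' b"
proof -
  have "frag_of (a \<oplus>\<^bsub>A\<^esub> a', b) - (frag_of (a, b) + frag_of (a', b)) \<in> bilinearity_relators A B"
    using bilinearity_relators.left[OF assms] by (simp add: diff_diff_eq)
  then have "frag_of (a \<oplus>\<^bsub>A\<^esub> a', b) - (frag_of (a, b) + frag_of (a', b)) \<in> K"
    unfolding tensor_kernel_def by (rule generate.incl)
  then have "pure_tensor A B (a \<oplus>\<^bsub>A\<^esub> a') b = K +>\<^bsub>P\<^esub> (frag_of (a, b) \<oplus>\<^bsub>P\<^esub> frag_of (a', b))"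
    unfolding pure_tensor_def using assms
    by (intro coset_eqI K.a_closed frag_of_closed) (simp_all add: ops_P)
  also have "\<dots> = pure_tensor A B a b \<oplus>\<^bsub>tensor_algebra A B\<^esub> pure_tensor A B a' b"
    unfolding pure_tensor_def using assms by (intro alg_homD(3)[OF pair_proj] frag_of_closed)
  finally show ?thesis .
qed

lemma pure_tensor_mult:
  assumes "a \<in> carrier A" "a' \<in> carrier A" "b \<in> carrier B" "b' \<in> carrier B"
  shows "pure_tensor A B a b \<otimes>\<^bsub>tensor_algebra A B\<^esub> pure_tensor A B a' b' =
    pure_tensor A B (a \<otimes>\<^bsub>A\<^esub> a') (b \<otimes>\<^bsub>B\<^esub> b')"
  unfolding pure_tensor_def using assms
  by (simp add: alg_homD(2)[OF pair_proj, symmetric] frag_of_closed ops_P)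

lemma pure_tensor_one: "pure_tensor A B \<one>\<^bsub>A\<^esub> \<one>\<^bsub>B\<^esub> = \<one>\<^bsub>tensor_algebra A B\<^esub>"
  unfolding pure_tensor_def using alg_homD(4)[OF pair_proj] by (simp add: ops_P)

lemma pure_tensor_ring_hom: "(\<lambda>a. pure_tensor A B a \<one>\<^bsub>B\<^esub>) \<in> ring_hom A (tensor_algebra A B)"
  by (intro ring_hom_memI)
    (simp_all add: pure_tensor_closed pure_tensor_mult pure_tensor_add_left pure_tensor_one)

text \<open>This is extension of scalars: a mere ring homomorphism \<open>\<rho>\<close> suffices,
  because linearity over \<open>B\<close> comes from the scalars of \<open>C\<close>. The rule for
  pairs extends additively to the free abelian group. It is multiplicative because scalars commute
  with everything in \<open>C\<close>, and it kills the bilinearity relators because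
  \<open>\<rho>\<close> and the scalar action are additive.\<close>

lemma tensor_algebra_hom:
  assumes C: "assoc_algebra B C" and \<rho>: "\<rho> \<in> ring_hom A C"
  obtains \<Psi> where "\<Psi> \<in> alg_hom B (tensor_algebra A B) C"
    and "\<And>a b. \<lbrakk>a \<in> carrier A; b \<in> carrier B\<rbrakk> \<Longrightarrow> \<Psi> (pure_tensor A B a b) = b \<odot>\<^bsub>C\<^esub> \<rho> a"
proof -
  interpret C: assoc_algebra B C by (rule C)
  note \<rho> = ring_hom_closed[OF \<rho>] ring_hom_mult[OF \<rho>] ring_hom_add[OF \<rho>] ring_hom_one[OF \<rho>]
  have "(\<lambda>(a, b). b \<odot>\<^bsub>C\<^esub> \<rho> a) ` (carrier A \<times> carrier B) \<subseteq> carrier (add_monoid C)"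
    by (auto simp: \<rho>)
  then obtain h where h: "h \<in> hom (free_Abelian_group (carrier A \<times> carrier B)) (add_monoid C)"
    and "\<And>u. u \<in> carrier A \<times> carrier B \<Longrightarrow> h (frag_of u) = (\<lambda>(a, b). b \<odot>\<^bsub>C\<^esub> \<rho> a) u"
    using comm_group.free_Abelian_group_universal[OF C.a_comm_group] by blast
  then have h_of: "h (frag_of (a, b)) = b \<odot>\<^bsub>C\<^esub> \<rho> a" if "a \<in> carrier A" "b \<in> carrier B" for a b
    using that by simp
  have h_closed: "h x \<in> carrier C" if "x \<in> carrier P" for x
    using hom_in_carrier[OF h] that by (simp add: pair_algebra_def)
  have h_add: "h (x \<oplus>\<^bsub>P\<^esub> y) = h x \<oplus>\<^bsub>C\<^esub> h y" if "x \<in> carrier P" "y \<in> carrier P" for x y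
    using hom_mult[OF h] that by (simp add: pair_algebra_def)
  have h_zero: "h \<zero>\<^bsub>P\<^esub> = \<zero>\<^bsub>C\<^esub>"
    by (rule C.add.l_cancel_one[THEN iffD1, of "h \<zero>\<^bsub>P\<^esub>"])
      (simp_all add: h_add[symmetric] h_closed)
  have h_minus: "h (\<ominus>\<^bsub>P\<^esub> x) = \<ominus>\<^bsub>C\<^esub> h x" if "x \<in> carrier P" for x
    using h_add[of "\<ominus>\<^bsub>P\<^esub> x" x] that
    by (intro C.minus_equality[symmetric]) (auto simp: h_closed h_zero K.l_neg)
  have smult_commute: "b' \<odot>\<^bsub>C\<^esub> (b \<odot>\<^bsub>C\<^esub> x) = b \<odot>\<^bsub>C\<^esub> (b' \<odot>\<^bsub>C\<^esub> x)"
    if "b \<in> carrier B" "b' \<in> carrier B" "x \<in> carrier C" for b b' x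
    using that by (simp add: C.smult_assoc1[symmetric] B.m_comm)
  have h_mult: "h (x \<otimes>\<^bsub>P\<^esub> y) = h x \<otimes>\<^bsub>C\<^esub> h y" if "x \<in> carrier P" and y: "y \<in> carrier P" for x y
    using that(1)
  proof (induction rule: P_induct)
    case (one a b)
    note ab = this
    from y show ?case
    proof (induction rule: P_induct)
      case (one a' b')
      then show ?case
        using ab by (simp add: ops_P h_of \<rho> smult_commute C.smult_mult_left C.smult_mult_right C.smult_assoc1)
    qed (use ab in \<open>auto simp: frag_of_closed h_zero h_closed h_add h_minus K.r_distr C.r_distr
        K.r_minus C.r_minus\<close>)
  qed (use y in \<open>auto simp: h_zero h_closed h_add h_minus K.l_distr C.l_distr
      K.l_minus C.l_minus\<close>)
  have hom: "h \<in> alg_hom B P C"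
  proof (rule alg_homI)
    show "h (c \<odot>\<^bsub>P\<^esub> x) = c \<odot>\<^bsub>C\<^esub> h x" if "c \<in> carrier B" "x \<in> carrier P" for c x
      using that by (simp add: smult_P h_mult frag_of_closed h_of \<rho> h_closed C.smult_mult_left)
  qed (simp_all add: h_closed h_add h_mult, simp add: ops_P h_of \<rho>)
  have h_diff: "h (x - y) = h x \<oplus>\<^bsub>C\<^esub> \<ominus>\<^bsub>C\<^esub> h y" if "x \<in> carrier P" "y \<in> carrier P" for x y
    using that by (simp add: minus_P(2) h_add h_minus)
  have rearrange: "x \<oplus>\<^bsub>C\<^esub> y \<oplus>\<^bsub>C\<^esub> \<ominus>\<^bsub>C\<^esub> x \<oplus>\<^bsub>C\<^esub> \<ominus>\<^bsub>C\<^esub> y = \<zero>\<^bsub>C\<^esub>"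
    if "x \<in> carrier C" "y \<in> carrier C" for x y
    using that by (simp add: C.a_assoc[of "x \<oplus>\<^bsub>C\<^esub> y"] C.minus_add[symmetric] C.r_neg)
  have rel: "h x = \<zero>\<^bsub>C\<^esub>" if "x \<in> bilinearity_relators A B" for x
    using that
  proof (cases rule: bilinearity_relators.cases)
    case (left a a' b)
    have "h x = h (frag_of (a \<oplus>\<^bsub>A\<^esub> a', b)) \<oplus>\<^bsub>C\<^esub> \<ominus>\<^bsub>C\<^esub> h (frag_of (a, b)) \<oplus>\<^bsub>C\<^esub> \<ominus>\<^bsub>C\<^esub> h (frag_of (a', b))"
      using left(2-) by (simp only: left(1) h_diff frag_of_closed minus_P(1) A.add.m_closed)
    also have "\<dots> = \<zero>\<^bsub>C\<^esub>"
      using left(2-) by (simp add: h_of \<rho> C.smult_r_distr rearrange)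
    finally show ?thesis .
  next
    case (right a b b')
    have "h x = h (frag_of (a, b \<oplus>\<^bsub>B\<^esub> b')) \<oplus>\<^bsub>C\<^esub> \<ominus>\<^bsub>C\<^esub> h (frag_of (a, b)) \<oplus>\<^bsub>C\<^esub> \<ominus>\<^bsub>C\<^esub> h (frag_of (a, b'))"
      using right(2-) by (simp only: right(1) h_diff frag_of_closed minus_P(1) B.add.m_closed)
    also have "\<dots> = \<zero>\<^bsub>C\<^esub>"
      using right(2-) by (simp add: h_of \<rho> C.smult_l_distr rearrange)
    finally show ?thesis .
  qed
  have kernel: "h x = \<zero>\<^bsub>C\<^esub>" if "x \<in> K" for x
  proof -
    interpret h: ring_hom_ring P C h
      by (rule ring_hom_ringI2[OF K.ring_axioms C.ring_axioms alg_homD(6)[OF hom]])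
    \<comment> \<open>\<open>K\<close> is the additive subgroup generated by the relators, so it
      lies in every additive subgroup that contains them.\<close>
    have "subgroup (a_kernel P C h) (add_monoid P)"
      by (rule additive_subgroup.a_subgroup[OF ideal.axioms(1)[OF h.kernel_is_ideal]])
    moreover have "u \<in> carrier P" if "u \<in> bilinearity_relators A B" for u
      using that by cases (auto intro!: minus_P(1) frag_of_closed)
    then have "bilinearity_relators A B \<subseteq> a_kernel P C h"
      using rel unfolding a_kernel_def' by blast
    ultimately have "K \<subseteq> a_kernel P C h"
      unfolding tensor_kernel_def by (rule group.generate_subgroup_incl[OF K.a_group, rotated])
    then show ?thesis using that unfolding a_kernel_def' by blast
  qed
  obtain \<Psi> where \<Psi>: "\<Psi> \<in> alg_hom B (quot_algebra P K) C"
    and coset: "\<And>x. x \<in> carrier P \<Longrightarrow> \<Psi> (K +>\<^bsub>P\<^esub> x) = h x"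
    using quot_algebra_hom[OF K.ideal_axioms C.ring_axioms hom kernel pair_scalar] by blast
  show thesis
  proof (rule that[of \<Psi>])
    show "\<Psi> \<in> alg_hom B (tensor_algebra A B) C"
      unfolding tensor_algebra_def by (rule \<Psi>)
    show "\<Psi> (pure_tensor A B a b) = b \<odot>\<^bsub>C\<^esub> \<rho> a" if "a \<in> carrier A" "b \<in> carrier B" for a b
      unfolding pure_tensor_def using that by (simp add: coset frag_of_closed h_of)
  qed
qed

end

section \<open>The Hecke relations in the Hecke-Hopf algebra\<close>

text \<open>\<open>J\<close> will be the kernel of an evaluation. An identity in the target becomes
  a membership in \<open>J\<close>, and a membership is certified by an explicit combination of
  relators, checked by plain ring arithmetic in the type of noncommutative polynomials.\<close>

locale two_sided_ideal =
  fixes J :: "'a::ring_1 set"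
  assumes add: "\<lbrakk>x \<in> J; y \<in> J\<rbrakk> \<Longrightarrow> x + y \<in> J"
    and l_mult: "x \<in> J \<Longrightarrow> a * x \<in> J"
    and r_mult: "x \<in> J \<Longrightarrow> x * a \<in> J"
begin

lemma diff: "\<lbrakk>x \<in> J; y \<in> J\<rbrakk> \<Longrightarrow> x - y \<in> J"
  using add[OF _ l_mult[of y "- 1"], of x] by simp

text \<open>Modulo \<open>J\<close> the square is \<open>1 + c (s - 1) + c^2 D\<close>, which
  regroups as \<open>c (s + c D) + (1 - c)\<close>. For \<open>c = 1 - q\<close> this is the
  quadratic Hecke relation.\<close>

lemma quadratic:
  assumes "\<And>x. x * c = c * x"
    and "s * s - 1 \<in> J" "s * D + D * s - (s - 1) \<in> J" "D * D - D \<in> J"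
  shows "(s + c * D) * (s + c * D) - (c * (s + c * D) + (1 - c)) \<in> J"
proof -
  have left_commute: "x * (c * y) = c * (x * y)" for x y
    using assms(1) by (metis mult.assoc)
  have "(s + c * D) * (s + c * D) - (c * (s + c * D) + (1 - c)) =
      (s * s - 1) + c * (s * D + D * s - (s - 1)) + c * (c * (D * D - D))"
    by (simp add: algebra_simps left_commute[of s] left_commute[of D])
  also have "\<dots> \<in> J"
    by (intro add diff l_mult r_mult assms)
  finally show ?thesis .
qed

lemma commute:
  assumes "\<And>x. x * c = c * x"
    and "s * t - t * s \<in> J" "D * t - t * D \<in> J" "E * s - s * E \<in> J" "D * E - E * D \<in> J"
  shows "(s + c * D) * (t + c * E) - (t + c * E) * (s + c * D) \<in> J"
proof -
  have left_commute: "x * (c * y) = c * (x * y)" for x y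
    using assms(1) by (metis mult.assoc)
  have "(s + c * D) * (t + c * E) - (t + c * E) * (s + c * D) =
      (s * t - t * s) + c * ((D * t - t * D) - (E * s - s * E)) + c * (c * (D * E - E * D))"
    by (simp add: algebra_simps left_commute[of s] left_commute[of t] left_commute[of D] left_commute[of E])
  also have "\<dots> \<in> J"
    by (intro add diff l_mult r_mult assms)
  finally show ?thesis .
qed

text \<open>Modulo \<open>J\<close>, \<open>t D t = t (D t s) s = t (t s E) s = s E s\<close>: a
  factor \<open>s s\<close> is inserted at the end and \<open>t t\<close> is cancelled at the
  front.\<close>

lemma near_conjugate:
  assumes "s * s - 1 \<in> J" "t * t - 1 \<in> J" "D * t * s - t * s * E \<in> J"
  shows "t * D * t - s * E * s \<in> J"
proof -
  have "t * D * t - s * E * s =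
      t * (D * t * s - t * s * E) * s - t * D * t * (s * s - 1) + (t * t - 1) * (s * E * s)"
    by (simp add: algebra_simps)
  also have "\<dots> \<in> J"
    by (intro add diff l_mult r_mult assms)
  finally show ?thesis .
qed

text \<open>The braid relation between \<open>D\<close> and \<open>E\<close> is absent from the
  defining relations, but it is the coefficient of \<open>c^3\<close> in the braid relation to be
  proved. It is first obtained with an extra factor \<open>s\<close> on the right, and
  \<open>s s = 1\<close> then removes this factor.\<close>

lemma near_DED:
  assumes ss: "s * s - 1 \<in> J" and sD: "s * D + D * s - (s - 1) \<in> J"
    and DD: "D * D - D \<in> J" and EE: "E * E - E \<in> J"
    and x: "E * s * E - (s * E * D + D * E * s + s * E * s) \<in> J"
  shows "D * E * D - E * D * E \<in> J"
proof -
  define S where "S = s * s - 1"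
  define Y where "Y = s * D + D * s - (s - 1)"
  define D' where "D' = D * D - D"
  define E' where "E' = E * E - E"
  define X where "X = E * s * E - (s * E * D + D * E * s + s * E * s)"
  note J = assms[folded S_def Y_def D'_def E'_def X_def]
  \<comment> \<open>Rewrite both sides of \<open>E (E s E) = E s E\<close> with \<open>X\<close> and reduce with the other relations.\<close>
  have "E * D * E * s - D * E * D * s =
      X - X * D - X * s - E * X + E' * (s * E)
      - s * E * D' - D * E * S - s * E * S - s * E * Y - D * E * Y"
    unfolding S_def Y_def D'_def E'_def X_def by (simp add: algebra_simps)
  also have "\<dots> \<in> J"
    by (simp only: add diff l_mult r_mult J)
  finally have "E * D * E * s - D * E * D * s \<in> J" .
  moreover have "D * E * D - E * D * E = (E * D * E - D * E * D) * S - (E * D * E * s - D * E * D * s) * s"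
    unfolding S_def by (simp add: algebra_simps)
  ultimately show ?thesis
    by (simp only: diff l_mult r_mult J)
qed

text \<open>The powers of \<open>c\<close> are compared. The constant coefficient is the braid
  relation of \<open>s\<close> and \<open>t\<close>. The linear one combines
  \<open>D t s = t s E\<close> and \<open>E s t = s t D\<close>, the quadratic one combines the two
  relations for \<open>E s E\<close> and \<open>D t D\<close>; both leave a multiple of
  \<open>t D t - s E s\<close>, which \<open>near_conjugate\<close> handles. The cubic one is
  \<open>near_DED\<close>.\<close>

lemma braid:
  assumes c: "\<And>x. x * c = c * x"
    and s: "s * s - 1 \<in> J" "s * D + D * s - (s - 1) \<in> J" "D * D - D \<in> J"
    and t: "t * t - 1 \<in> J" "E * E - E \<in> J"
    and st: "s * t * s - t * s * t \<in> J"
    and "D * t * s - t * s * E \<in> J" "E * s * t - s * t * D \<in> J"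
    and "E * s * E - (s * E * D + D * E * s + s * E * s) \<in> J"
    and "D * t * D - (t * D * E + E * D * t + t * D * t) \<in> J"
  shows "(s + c * D) * (t + c * E) * (s + c * D) - (t + c * E) * (s + c * D) * (t + c * E) \<in> J"
proof -
  have left_commute: "x * (c * y) = c * (x * y)" for x y
    using c by (metis mult.assoc)
  have conj: "t * D * t - s * E * s \<in> J"
    by (rule near_conjugate) (use assms in auto)
  have DED: "D * E * D - E * D * E \<in> J"
    by (rule near_DED) (use assms in auto)
  have "(s + c * D) * (t + c * E) * (s + c * D) - (t + c * E) * (s + c * D) * (t + c * E) =
      (s * t * s - t * s * t)
      + c * ((D * t * s - t * s * E) - (E * s * t - s * t * D) - (t * D * t - s * E * s))
      + c * (c * ((D * t * D - (t * D * E + E * D * t + t * D * t))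
          - (E * s * E - (s * E * D + D * E * s + s * E * s)) + (t * D * t - s * E * s)))
      + c * (c * (c * (D * E * D - E * D * E)))"
    by (simp add: algebra_simps left_commute[of s] left_commute[of t] left_commute[of D] left_commute[of E])
  also have "\<dots> \<in> J"
    by (simp only: add diff l_mult assms conj DED)
  finally show ?thesis .
qed

end

text \<open>With \<open>X = UNIV\<close> every polynomial belongs to the free algebra, so the kernel
  is an ideal of the entire polynomial type, as the ideal computations require. In return
  \<open>g\<close> has to take values in the carrier at every letter.\<close>

lemma free_eval_kernel:
  fixes B (structure)
  assumes B: "assoc_algebra type_ring B" and g: "\<And>x. g x \<in> carrier B"
  shows "two_sided_ideal {p. free_eval B g p = \<zero>}"
    and "free_eval B g p = free_eval B g q \<longleftrightarrow> p - q \<in> {p. free_eval B g p = \<zero>}"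
proof -
  interpret B: assoc_algebra type_ring B by (rule B)
  have closed: "free_eval B g p \<in> carrier B" for p
    by (rule free_eval_closed[where X = UNIV, OF B g]) simp
  have add: "free_eval B g (p + q) = free_eval B g p \<oplus> free_eval B g q" for p q
    by (rule free_eval_add[where X = UNIV, OF B g]) simp_all
  have mult: "free_eval B g (p * q) = free_eval B g p \<otimes> free_eval B g q" for p q
    by (rule free_eval_mult[where X = UNIV, OF B g]) simp_all
  show "two_sided_ideal {p. free_eval B g p = \<zero>}"
    by unfold_locales (auto simp: add mult closed)
  have "free_eval B g p = free_eval B g (p - q) \<oplus> free_eval B g q"
    using add[of "p - q" q] by simp
  then show "free_eval B g p = free_eval B g q \<longleftrightarrow> p - q \<in> {p. free_eval B g p = \<zero>}"
    using closed[of "p - q"] closed[of q] B.add.r_cancel_one' by auto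
qed

section \<open>The Hecke relations for the prescribed images of the generators\<close>

definition hecke_image :: "nat \<Rightarrow> nat \<Rightarrow> ((hecke_hopf_gen free_monoid \<Rightarrow>\<^sub>0 int) set \<times> laurent \<Rightarrow>\<^sub>0 int) set"
  where "hecke_image n i = hecke_hopf_embed n (hecke_hopf_s n i) \<oplus>\<^bsub>hecke_hopf_laurent n\<^esub>
    (1 - \<q>) \<odot>\<^bsub>hecke_hopf_laurent n\<^esub> hecke_hopf_embed n (hecke_hopf_D n i)"

lemma hecke_hopf_rel_closed:
  "hecke_hopf_rel n l r \<Longrightarrow>
    l \<in> carrier (free_algebra (hecke_hopf_gens n)) \<and> r \<in> carrier (free_algebra (hecke_hopf_gens n))"
  by (auto elim!: hecke_hopf_rel.cases simp: power2_eq_square hecke_hopf_gens_def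
      intro!: free_algebra_closed)

lemma hecke_rel_closed:
  "hecke_rel n l r \<Longrightarrow> l \<in> carrier (free_algebra {1..<n}) \<and> r \<in> carrier (free_algebra {1..<n})"
  by (auto elim!: hecke_rel.cases simp: power2_eq_square intro!: free_algebra_closed)

lemma ring_hecke_hopf: "ring (hecke_hopf n)"
  by (rule assoc_algebra.axioms(2)[OF assoc_algebra_hecke_hopf])

context
  fixes n :: nat
begin

private abbreviation (input) "T \<equiv> hecke_hopf_laurent n"

text \<open>The default zero gives a value in the carrier to the letters with an index outside
  \<open>1, ..., n - 1\<close>, so that polynomials in all letters can be evaluated.\<close>

private definition gen_image
  where "gen_image x = (if x \<in> hecke_hopf_gens n
    then hecke_hopf_embed n (presented_gen (hecke_hopf_gens n) (hecke_hopf_rel n) x) else \<zero>\<^bsub>T\<^esub>)"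

interpretation T: assoc_algebra laurent_ring "hecke_hopf_laurent n"
  by (rule assoc_algebra_hecke_hopf_laurent)

private lemma embed: "hecke_hopf_embed n \<in> ring_hom (hecke_hopf n) T"
  using pure_tensor_ring_hom[OF ring_hecke_hopf cring_type_ring, of n]
  by (simp add: hecke_hopf_embed_def[abs_def] hecke_hopf_laurent_def)

private lemma gen_image_closed: "gen_image x \<in> carrier T"
  using presented_gen_closed[OF hecke_hopf_rel_closed]
  by (auto simp: gen_image_def hecke_hopf_def intro!: ring_hom_closed[OF embed])

text \<open>The defining relations of \<open>H(S_n)\<close> have integer coefficients, while the
  constant \<open>c = 1 - q\<close> puts the ideal computations over Laurent polynomials.
  \<open>proj\<close> and \<open>ev\<close> start from these two kinds of polynomials but agree on
  generators and respect sums, differences and products. A defining relation known through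
  \<open>proj\<close> is thereby read as a membership in \<open>J\<close>.\<close>

private definition proj
  where "proj p = hecke_hopf_embed n
    (relations_ideal (hecke_hopf_gens n) (hecke_hopf_rel n) +>\<^bsub>free_algebra (hecke_hopf_gens n)\<^esub> p)"

private lemma proj_rel: "hecke_hopf_rel n l r \<Longrightarrow> proj l = proj r"
  unfolding proj_def using presented_algebra_relation[OF hecke_hopf_rel_closed] by simp

private abbreviation (input) "F \<equiv> free_algebra (hecke_hopf_gens n) :: (int, _) module"

private lemma proj_ring_hom: "proj \<in> ring_hom F T"
  using ring_hom_trans[OF alg_homD(6)[OF presented_algebra_proj[OF hecke_hopf_rel_closed]]
      embed[unfolded hecke_hopf_def]]
  by (simp add: proj_def[abs_def] comp_def)

private lemma proj_closed: "p \<in> carrier F \<Longrightarrow> proj p \<in> carrier T"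
  by (rule ring_hom_closed[OF proj_ring_hom])

private lemma proj_mult: "\<lbrakk>p \<in> carrier F; q \<in> carrier F\<rbrakk> \<Longrightarrow> proj (p * q) = proj p \<otimes>\<^bsub>T\<^esub> proj q"
  using ring_hom_mult[OF proj_ring_hom] by (simp add: free_algebra_ops)

private lemma proj_add: "\<lbrakk>p \<in> carrier F; q \<in> carrier F\<rbrakk> \<Longrightarrow> proj (p + q) = proj p \<oplus>\<^bsub>T\<^esub> proj q"
  using ring_hom_add[OF proj_ring_hom] by (simp add: free_algebra_ops)

private lemma proj_one: "proj 1 = \<one>\<^bsub>T\<^esub>"
  using ring_hom_one[OF proj_ring_hom] by (simp add: free_algebra_ops)

private lemma proj_gen: "x \<in> hecke_hopf_gens n \<Longrightarrow> proj (gen x) = gen_image x"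
  by (simp add: proj_def gen_image_def presented_gen_def)

private lemma proj_diff:
  assumes "p \<in> carrier F" "q \<in> carrier F"
  shows "proj (p - q) = proj p \<ominus>\<^bsub>T\<^esub> proj q"
proof -
  have "proj p = proj (p - q) \<oplus>\<^bsub>T\<^esub> proj q"
    using proj_add[of "p - q" q] assms by (simp add: free_algebra_diff_closed)
  then show ?thesis
    using assms by (simp add: proj_closed free_algebra_diff_closed T.minus_eq T.a_assoc T.r_neg)
qed

private abbreviation (input) "ev \<equiv> free_eval T gen_image"

private lemma ev:
  "ev p \<in> carrier T" "ev (p * q) = ev p \<otimes>\<^bsub>T\<^esub> ev q" "ev (p + q) = ev p \<oplus>\<^bsub>T\<^esub> ev q"
  "ev (p - q) = ev p \<ominus>\<^bsub>T\<^esub> ev q" "ev 1 = \<one>\<^bsub>T\<^esub>" "ev (gen x) = gen_image x"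
  "ev (Poly_Mapping.single 0 c) = c \<odot>\<^bsub>T\<^esub> \<one>\<^bsub>T\<^esub>"
proof -
  note T = T.assoc_algebra_axioms gen_image_closed
  note hom = alg_homD[OF free_eval_alg_hom[where X = UNIV, OF T]]
  show "ev p \<in> carrier T" by (rule hom(1)) simp
  show "ev (p * q) = ev p \<otimes>\<^bsub>T\<^esub> ev q" using hom(2) by (simp add: free_algebra_ops)
  show "ev (p + q) = ev p \<oplus>\<^bsub>T\<^esub> ev q" using hom(3) by (simp add: free_algebra_ops)
  show "ev (p - q) = ev p \<ominus>\<^bsub>T\<^esub> ev q" by (rule free_eval_diff[where X = UNIV, OF T]) simp_all
  show "ev 1 = \<one>\<^bsub>T\<^esub>" using hom(4) by (simp add: free_algebra_ops)
  show "ev (gen x) = gen_image x" by (rule free_eval_gen[where X = UNIV, OF T]) simp_all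
  show "ev (Poly_Mapping.single 0 c) = c \<odot>\<^bsub>T\<^esub> \<one>\<^bsub>T\<^esub>" by (rule free_eval_const[where X = UNIV, OF T])
qed

private definition "J = {p. ev p = \<zero>\<^bsub>T\<^esub>}"

interpretation J: two_sided_ideal J
  unfolding J_def by (rule free_eval_kernel(1)[OF T.assoc_algebra_axioms gen_image_closed])

private lemma J_iff: "p - q \<in> J \<longleftrightarrow> ev p = ev q"
  unfolding J_def by (rule free_eval_kernel(2)[OF T.assoc_algebra_axioms gen_image_closed, symmetric])

private abbreviation (input) "sv i \<equiv> gen (S_gen i) :: hecke_hopf_gen free_monoid \<Rightarrow>\<^sub>0 laurent"
private abbreviation (input) "Dv i \<equiv> gen (D_gen i) :: hecke_hopf_gen free_monoid \<Rightarrow>\<^sub>0 laurent"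

private lemma gens: "i \<in> {1..<n} \<Longrightarrow> S_gen i \<in> hecke_hopf_gens n" "i \<in> {1..<n} \<Longrightarrow> D_gen i \<in> hecke_hopf_gens n"
  by (auto simp: hecke_hopf_gens_def)

private lemmas transfer_simps = J_iff ev proj_mult proj_add proj_diff proj_one proj_gen gens
  free_algebra_closed power2_eq_square

private lemma relations:
  assumes i: "i \<in> {1..<n}"
  shows "sv i * sv i - 1 \<in> J" "sv i * Dv i + Dv i * sv i - (sv i - 1) \<in> J" "Dv i * Dv i - Dv i \<in> J"
  using i proj_rel[OF hecke_hopf_rel.ss[OF i]] proj_rel[OF hecke_hopf_rel.sD[OF i]]
    proj_rel[OF hecke_hopf_rel.DD[OF i]]
  by (simp_all only: transfer_simps)

private lemma far_relations:
  assumes ij: "i \<in> {1..<n}" "j \<in> {1..<n}" "\<bar>int i - int j\<bar> > 1"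
  shows "sv j * sv i - sv i * sv j \<in> J" "Dv j * sv i - sv i * Dv j \<in> J" "Dv j * Dv i - Dv i * Dv j \<in> J"
  using ij(1,2) proj_rel[OF hecke_hopf_rel.far_ss[OF ij]] proj_rel[OF hecke_hopf_rel.far_Ds[OF ij]]
    proj_rel[OF hecke_hopf_rel.far_DD[OF ij]]
  by (simp_all only: transfer_simps)

private lemma near_relations:
  assumes ij: "i \<in> {1..<n}" "j \<in> {1..<n}" "\<bar>int i - int j\<bar> = 1"
  shows "sv j * sv i * sv j - sv i * sv j * sv i \<in> J" "Dv i * sv j * sv i - sv j * sv i * Dv j \<in> J"
    "Dv j * sv i * Dv j - (sv i * Dv j * Dv i + Dv i * Dv j * sv i + sv i * Dv j * sv i) \<in> J"
  using ij(1,2) proj_rel[OF hecke_hopf_rel.near_sss[OF ij]] proj_rel[OF hecke_hopf_rel.near_Dss[OF ij]]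
    proj_rel[OF hecke_hopf_rel.near_DsD[OF ij]]
  by (simp_all only: transfer_simps)

private definition "u i = sv i + Poly_Mapping.single 0 (1 - \<q>) * Dv i"

private lemma ev_u: "i \<in> {1..<n} \<Longrightarrow> ev (u i) = hecke_image n i"
  using T.smult_mult_left[of "1 - \<q>" "\<one>\<^bsub>T\<^esub>"] gen_image_closed[of "D_gen i"]
  by (simp add: u_def ev, simp add: gen_image_def gens hecke_image_def hecke_hopf_s_def hecke_hopf_D_def)

lemma hecke_image_closed: "i \<in> {1..<n} \<Longrightarrow> hecke_image n i \<in> carrier T"
  using ev(1)[of "u i"] ev_u by simp

text \<open>The polynomial \<open>u i\<close> evaluates to \<open>hecke_image n i\<close> under
  \<open>ev\<close>, so each Hecke relation turns into a membership in \<open>J\<close>, and the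
  ideal lemmas apply with the central constant \<open>c = 1 - q\<close>.\<close>

lemma hecke_image_rel:
  assumes "hecke_rel n l r"
  shows "free_eval T (hecke_image n) l = free_eval T (hecke_image n) r"
proof -
  note T = T.assoc_algebra_axioms hecke_image_closed
  note hom = alg_homD[OF free_eval_alg_hom[where X = "{1..<n}", OF T], unfolded free_algebra_ops]
  have fe: "free_eval T (hecke_image n) (gen i) = ev (u i)" if "i \<in> {1..<n}" for i
    using free_eval_gen[where X = "{1..<n}", OF T that] ev_u[OF that] by simp
  have const: "free_eval T (hecke_image n) (Poly_Mapping.single 0 c) = ev (Poly_Mapping.single 0 c)" for c
    using free_eval_const[where X = "{1..<n}", OF T] by (simp add: ev)
  have central: "x * Poly_Mapping.single 0 (1 - \<q>) = Poly_Mapping.single 0 (1 - \<q>) * x"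
    for x :: "hecke_hopf_gen free_monoid \<Rightarrow>\<^sub>0 laurent"
    by (rule single_zero_central)
  note eval = hom(2,3) fe const free_algebra_closed
  from assms show ?thesis
  proof cases
    case (braid i j)
    then have ji: "\<bar>int j - int i\<bar> = 1" by simp
    have "u i * u j * u i - u j * u i * u j \<in> J"
      unfolding u_def
      using relations[of i] relations[of j] near_relations[of i j] near_relations[of j i] braid ji
      by (intro J.braid central) simp_all
    then show ?thesis using braid by (simp only: J_iff eval ev(2))
  next
    case (commute i j)
    then have ji: "\<bar>int j - int i\<bar> > 1" by simp
    have "u i * u j - u j * u i \<in> J"
      unfolding u_def
      using far_relations[of i j] far_relations[of j i] commute ji
      by (intro J.commute central) simp_all
    then show ?thesis using commute by (simp only: J_iff eval ev(2))
  next
    case (quadratic i)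
    \<comment> \<open>The constant term \<open>1 - c\<close> of \<open>J.quadratic\<close> is
      \<open>q\<close>.\<close>
    have q: "1 - Poly_Mapping.single 0 (1 - \<q>) = Poly_Mapping.single (0 :: hecke_hopf_gen free_monoid) \<q>"
      using single_diff[of "0 :: hecke_hopf_gen free_monoid" 1 "1 - \<q>"] by simp
    have "u i * u i - (Poly_Mapping.single 0 (1 - \<q>) * u i + (1 - Poly_Mapping.single 0 (1 - \<q>))) \<in> J"
      unfolding u_def
      using relations[of i] quadratic by (intro J.quadratic central) simp_all
    then show ?thesis using quadratic by (simp only: q J_iff eval ev(2,3) power2_eq_square)
  qed
qed

end

unbundle permutation_syntax

section \<open>The regular representation\<close>

text \<open>The parameter \<open>h\<close> separates the scalars that act from the coefficients of
  the functions and affects the scalar multiplication alone. The same ring of operators on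
  Laurent-valued functions thus serves as an algebra over the integers, with
  \<open>h = of_int\<close>, and over the Laurent polynomials, with \<open>h = id\<close>.\<close>

definition endo_algebra :: "('r \<Rightarrow> 'k::comm_ring_1) \<Rightarrow> ('r, ('i \<Rightarrow> 'k) \<Rightarrow> 'i \<Rightarrow> 'k) module"
  where "endo_algebra h =
    \<lparr>carrier = {f. (\<forall>u v. f (\<lambda>i. u i + v i) = (\<lambda>i. f u i + f v i)) \<and> (\<forall>c u. f (\<lambda>i. c * u i) = (\<lambda>i. c * f u i))},
     monoid.mult = (\<circ>), one = id, ring.zero = (\<lambda>u i. 0), add = (\<lambda>f g u i. f u i + g u i),
     smult = (\<lambda>c f u i. h c * f u i)\<rparr>"

lemma endo_algebra_simps:
  "f \<in> carrier (endo_algebra h) \<longleftrightarrow>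
    (\<forall>u v. f (\<lambda>i. u i + v i) = (\<lambda>i. f u i + f v i)) \<and> (\<forall>c u. f (\<lambda>i. c * u i) = (\<lambda>i. c * f u i))"
  "f \<otimes>\<^bsub>endo_algebra h\<^esub> g = f \<circ> g" "\<one>\<^bsub>endo_algebra h\<^esub> = id"
  "f \<oplus>\<^bsub>endo_algebra h\<^esub> g = (\<lambda>u i. f u i + g u i)" "\<zero>\<^bsub>endo_algebra h\<^esub> = (\<lambda>u i. 0)"
  "c \<odot>\<^bsub>endo_algebra h\<^esub> f = (\<lambda>u i. h c * f u i)"
  by (simp_all add: endo_algebra_def)

lemma assoc_algebra_endo_algebra:
  fixes h :: "'r::comm_ring_1 \<Rightarrow> 'k::comm_ring_1"
  assumes h: "h 1 = 1" "\<And>a b. h (a + b) = h a + h b" "\<And>a b. h (a * b) = h a * h b"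
  shows "assoc_algebra type_ring (endo_algebra h :: ('r, ('i \<Rightarrow> 'k) \<Rightarrow> 'i \<Rightarrow> 'k) module)"
proof -
  let ?E = "endo_algebra h :: ('r, ('i \<Rightarrow> 'k) \<Rightarrow> 'i \<Rightarrow> 'k) module"
  have ab: "abelian_group ?E"
  proof (rule abelian_groupI)
    fix f assume f: "f \<in> carrier ?E"
    show "\<exists>g\<in>carrier ?E. g \<oplus>\<^bsub>?E\<^esub> f = \<zero>\<^bsub>?E\<^esub>"
      by (rule bexI[of _ "\<lambda>u i. - f u i"]) (use f in \<open>auto simp: endo_algebra_simps\<close>)
  qed (auto simp: endo_algebra_simps algebra_simps)
  have "ring ?E"
  proof (rule ringI)
    show "Group.monoid ?E"
      by (rule monoidI) (auto simp: endo_algebra_simps o_assoc)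
  qed (use ab in \<open>auto simp: endo_algebra_simps fun_eq_iff\<close>)
  then show ?thesis
    using ab by (intro assoc_algebra.intro moduleI assoc_algebra_axioms.intro cring_type_ring)
      (auto simp: endo_algebra_simps fun_eq_iff h algebra_simps)
qed

definition s_op :: "nat \<Rightarrow> (nat perm \<Rightarrow> 'k::comm_ring_1) \<Rightarrow> nat perm \<Rightarrow> 'k"
  where "s_op i u w = u (w * \<langle>i \<leftrightarrow> Suc i\<rangle>)"

definition D_op :: "nat \<Rightarrow> (nat perm \<Rightarrow> 'k::comm_ring_1) \<Rightarrow> nat perm \<Rightarrow> 'k"
  where "D_op i u w = (if w \<langle>$\<rangle> (Suc i) < w \<langle>$\<rangle> i then u w - u (w * \<langle>i \<leftrightarrow> Suc i\<rangle>) else 0)"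

lemma s_op_closed: "s_op i \<in> carrier (endo_algebra h)"
  by (simp add: endo_algebra_simps s_op_def fun_eq_iff)

lemma D_op_closed: "D_op i \<in> carrier (endo_algebra h)"
  by (simp add: endo_algebra_simps D_op_def fun_eq_iff algebra_simps)

lemma swap_swap: "\<langle>a \<leftrightarrow> b\<rangle> * \<langle>a \<leftrightarrow> b\<rangle> = 1"
proof (rule perm_eqI)
  fix x
  show "(\<langle>a \<leftrightarrow> b\<rangle> * \<langle>a \<leftrightarrow> b\<rangle>) \<langle>$\<rangle> x = 1 \<langle>$\<rangle> x"
    by (cases "x = a"; cases "x = b") (simp_all add: apply_times)
qed

lemma swap_braid:
  assumes "a \<noteq> b" "b \<noteq> c" "a \<noteq> c"
  shows "\<langle>b \<leftrightarrow> c\<rangle> * \<langle>a \<leftrightarrow> b\<rangle> * \<langle>b \<leftrightarrow> c\<rangle> = \<langle>a \<leftrightarrow> b\<rangle> * \<langle>b \<leftrightarrow> c\<rangle> * \<langle>a \<leftrightarrow> b\<rangle>"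
proof (rule perm_eqI)
  fix x
  show "(\<langle>b \<leftrightarrow> c\<rangle> * \<langle>a \<leftrightarrow> b\<rangle> * \<langle>b \<leftrightarrow> c\<rangle>) \<langle>$\<rangle> x = (\<langle>a \<leftrightarrow> b\<rangle> * \<langle>b \<leftrightarrow> c\<rangle> * \<langle>a \<leftrightarrow> b\<rangle>) \<langle>$\<rangle> x"
    using assms by (cases "x = a"; cases "x = b"; cases "x = c") (simp_all add: apply_times)
qed

text \<open>The leading factor \<open>w\<close> lets these equations rewrite left-associated
  products, the form in which the arguments of \<open>u\<close> appear, to a common shape.\<close>

lemma braid_cancel:
  fixes i :: nat and w :: "nat perm"
  shows "w * \<langle>Suc i \<leftrightarrow> Suc (Suc i)\<rangle> * \<langle>i \<leftrightarrow> Suc i\<rangle> * \<langle>Suc i \<leftrightarrow> Suc (Suc i)\<rangle> =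
    w * \<langle>i \<leftrightarrow> Suc i\<rangle> * \<langle>Suc i \<leftrightarrow> Suc (Suc i)\<rangle> * \<langle>i \<leftrightarrow> Suc i\<rangle>"
    "w * \<langle>j \<leftrightarrow> Suc j\<rangle> * \<langle>j \<leftrightarrow> Suc j\<rangle> = w"
  using arg_cong[OF swap_braid[of i "Suc i" "Suc (Suc i)"], of "(*) w"]
  by (simp_all add: mult.assoc swap_swap)

context
  fixes i :: nat and u :: "nat perm \<Rightarrow> 'k::comm_ring_1" and w :: "nat perm"
begin

private lemma distinct_values: "w \<langle>$\<rangle> i \<noteq> w \<langle>$\<rangle> (Suc i)" "w \<langle>$\<rangle> (Suc i) \<noteq> w \<langle>$\<rangle> (Suc (Suc i))"
  "w \<langle>$\<rangle> i \<noteq> w \<langle>$\<rangle> (Suc (Suc i))"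
  by (simp_all add: apply_inj)

private lemma cancel: "w * \<langle>i \<leftrightarrow> Suc i\<rangle> * \<langle>i \<leftrightarrow> Suc i\<rangle> = w"
  by (simp add: mult.assoc swap_swap)

text \<open>With \<open>f\<close> the descent indicator at \<open>i\<close> and
  \<open>s = s_i\<close>, the facts behind this are \<open>f f = f\<close>,
  \<open>f + s f = 1\<close> and \<open>s (1 - s) = - (1 - s)\<close>. For example,
  \<open>D D = f (f + s f) (1 - s) = f (1 - s)\<close>.\<close>

lemma op_quadratic:
  "s_op i (s_op i u) w = u w"
  "s_op i (D_op i u) w + D_op i (s_op i u) w = s_op i u w - u w"
  "D_op i (D_op i u) w = D_op i u w"
  using distinct_values(1) by (auto simp: s_op_def D_op_def apply_times cancel)

text \<open>The two transpositions move disjoint pairs of places, so they commute, and neither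
  changes whether there is a descent at the other index.\<close>

lemma op_far:
  assumes "\<bar>int i - int j\<bar> > 1"
  shows "s_op j (s_op i u) w = s_op i (s_op j u) w"
    "D_op j (s_op i u) w = s_op i (D_op j u) w"
    "D_op j (D_op i u) w = D_op i (D_op j u) w"
proof -
  have ne: "i \<noteq> j" "i \<noteq> Suc j" "Suc i \<noteq> j"
    using assms by auto
  moreover have "w * \<langle>j \<leftrightarrow> Suc j\<rangle> * \<langle>i \<leftrightarrow> Suc i\<rangle> = w * \<langle>i \<leftrightarrow> Suc i\<rangle> * \<langle>j \<leftrightarrow> Suc j\<rangle>"
    using ne perm_mult_commute[of "\<langle>j \<leftrightarrow> Suc j\<rangle>" "\<langle>i \<leftrightarrow> Suc i\<rangle>"]
    by (simp add: mult.assoc affected_swap)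
  ultimately show "s_op j (s_op i u) w = s_op i (s_op j u) w"
    "D_op j (s_op i u) w = s_op i (D_op j u) w"
    "D_op j (D_op i u) w = D_op i (D_op j u) w"
    by (auto simp: s_op_def D_op_def apply_times)
qed

text \<open>Every argument of \<open>u\<close> is \<open>w\<close> times a permutation of the places
  \<open>i\<close>, \<open>i + 1\<close>, \<open>i + 2\<close>, and every indicator compares two of
  the three distinct values of \<open>w\<close> there. This leaves a finite check over the relative
  orders of these values. The last four equations give both orientations of the two mixed
  relations.\<close>

lemma op_near:
  assumes "j = Suc i"
  shows "s_op j (s_op i (s_op j u)) w = s_op i (s_op j (s_op i u)) w"
    "D_op i (s_op j (s_op i u)) w = s_op j (s_op i (D_op j u)) w"
    "D_op j (s_op i (s_op j u)) w = s_op i (s_op j (D_op i u)) w"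
    "D_op j (s_op i (D_op j u)) w =
      s_op i (D_op j (D_op i u)) w + D_op i (D_op j (s_op i u)) w + s_op i (D_op j (s_op i u)) w"
    "D_op i (s_op j (D_op i u)) w =
      s_op j (D_op i (D_op j u)) w + D_op j (D_op i (s_op j u)) w + s_op j (D_op i (s_op j u)) w"
  using distinct_values
  by (auto simp: assms s_op_def D_op_def apply_times braid_cancel)

end

section \<open>Reduced words\<close>

text \<open>The one-line notation \<open>ws\<close> of a permutation of \<open>{1..k}\<close> arises from the identity by
  arranging the values below \<open>k\<close> first and then moving \<open>k\<close> from the last place to the left.
  The letters act from the right end of the word, the letter \<open>i\<close> exchanging the entries at the
  places \<open>i\<close> and \<open>i + 1\<close>.\<close>

fun perm_word :: "nat \<Rightarrow> nat list \<Rightarrow> nat list"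
  where
    "perm_word 0 ws = []"
  | "perm_word (Suc k) ws =
      [Suc (length (takeWhile (\<lambda>x. x \<noteq> Suc k) ws))..<Suc k] @ perm_word k (removeAll (Suc k) ws)"

lemma perm_word_split:
  "Suc k \<notin> set us \<Longrightarrow> Suc k \<notin> set vs \<Longrightarrow>
    perm_word (Suc k) (us @ Suc k # vs) = [Suc (length us)..<Suc k] @ perm_word k (us @ vs)"
  by (subst perm_word.simps, subst takeWhile_append2) (auto simp del: upt_Suc)

lemma perm_word_id: "perm_word k [1..<Suc k] = []"
proof (induction k)
  case (Suc k)
  have "[1..<Suc (Suc k)] = [1..<Suc k] @ Suc k # []" by simp
  then show ?case
    using perm_word_split[of k "[1..<Suc k]" "[]"] Suc by (simp del: upt_Suc perm_word.simps)
qed simp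

lemma perm_word_subset: "set (perm_word k ws) \<subseteq> {1..<k}"
proof (induction k ws rule: perm_word.induct)
  case (2 k ws)
  then show ?case by fastforce
qed simp

lemma (in Group.monoid) word_eval_commute:
  assumes "x \<in> carrier G" "g ` set is \<subseteq> carrier G" "\<And>i. i \<in> set is \<Longrightarrow> x \<otimes> g i = g i \<otimes> x"
  shows "x \<otimes> word_eval G g is = word_eval G g is \<otimes> x"
  using assms(2,3)
proof (induction "is")
  case (Cons i "is")
  then have c: "g i \<in> carrier G" "word_eval G g is \<in> carrier G"
    by (auto intro: word_eval_closed)
  have "x \<otimes> (g i \<otimes> word_eval G g is) = g i \<otimes> (x \<otimes> word_eval G g is)"
    using Cons.prems c assms(1) by (simp add: m_assoc[symmetric])
  then show ?case
    using Cons c assms(1) by (simp add: m_assoc)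
qed (use assms(1) in simp)

text \<open>The elements \<open>g i\<close> are images of the generators of the braid monoid on
  \<open>n\<close> strands. The results will be applied to rescaled Hecke generators.\<close>

locale braid_family = Group.monoid G for G (structure) +
  fixes g :: "nat \<Rightarrow> 'a" and n :: nat
  assumes g_closed: "i \<in> {1..<n} \<Longrightarrow> g i \<in> carrier G"
    and g_braid: "\<lbrakk>i \<in> {1..<n}; Suc i \<in> {1..<n}\<rbrakk> \<Longrightarrow> g i \<otimes> g (Suc i) \<otimes> g i = g (Suc i) \<otimes> g i \<otimes> g (Suc i)"
    and g_commute: "\<lbrakk>i \<in> {1..<n}; j \<in> {1..<n}; Suc i < j\<rbrakk> \<Longrightarrow> g i \<otimes> g j = g j \<otimes> g i"
begin

abbreviation "ev \<equiv> word_eval G g"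

lemma ev_closed: "set is \<subseteq> {1..<n} \<Longrightarrow> ev is \<in> carrier G"
  by (rule word_eval_closed) (use g_closed in auto)

lemma ev_append: "set is \<subseteq> {1..<n} \<Longrightarrow> set js \<subseteq> {1..<n} \<Longrightarrow> ev (is @ js) = ev is \<otimes> ev js"
  by (rule word_eval_append) (use g_closed in auto)

lemma ev_commute:
  assumes "i \<in> {1..<n}" "set is \<subseteq> {1..<n}" "\<And>j. j \<in> set is \<Longrightarrow> Suc i < j \<or> Suc j < i"
  shows "g i \<otimes> ev is = ev is \<otimes> g i"
proof (rule word_eval_commute)
  show "g i \<otimes> g j = g j \<otimes> g i" if "j \<in> set is" for j
    using assms that g_commute[of i j] g_commute[of j i] by (metis subsetD)
qed (use assms g_closed in auto)

text \<open>The factor \<open>g i\<close> passes the letters below \<open>i - 1\<close> by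
  commutation. There \<open>g i g (i - 1) g i\<close> becomes
  \<open>g (i - 1) g i g (i - 1)\<close>, and the last factor \<open>g (i - 1)\<close> commutes with
  the letters above \<open>i\<close>.\<close>

lemma ev_upt_shift:
  assumes "1 \<le> p" "p < i" "i < k" "k \<le> n"
  shows "g i \<otimes> ev [p..<k] = ev [p..<k] \<otimes> g (i - 1)"
proof -
  obtain h where h: "i = Suc h" using assms by (cases i) auto
  have split: "[p..<k] = [p..<h] @ [h, i] @ [Suc i..<k]"
    using assms h upt_add_eq_append[of p h "k - h"] by (simp add: upt_conv_Cons)
  have c: "ev [p..<h] \<in> carrier G" "ev [Suc i..<k] \<in> carrier G" "g h \<in> carrier G" "g i \<in> carrier G"
    using assms h by (auto intro!: ev_closed g_closed)
  have ev: "ev [p..<k] = ev [p..<h] \<otimes> (g h \<otimes> (g i \<otimes> ev [Suc i..<k]))"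
    unfolding split using assms h c by (subst ev_append) (auto simp: g_closed)
  have "g i \<otimes> ev [p..<k] = g i \<otimes> ev [p..<h] \<otimes> (g h \<otimes> (g i \<otimes> ev [Suc i..<k]))"
    using c by (simp add: ev m_assoc)
  also have "g i \<otimes> ev [p..<h] = ev [p..<h] \<otimes> g i"
    using assms h by (intro ev_commute) auto
  also have "\<dots> \<otimes> (g h \<otimes> (g i \<otimes> ev [Suc i..<k])) = ev [p..<h] \<otimes> ((g i \<otimes> g h \<otimes> g i) \<otimes> ev [Suc i..<k])"
    using c by (simp add: m_assoc)
  also have "g i \<otimes> g h \<otimes> g i = g h \<otimes> g i \<otimes> g h"
    using g_braid[of h] assms h by simp
  also have "(g h \<otimes> g i \<otimes> g h) \<otimes> ev [Suc i..<k] = g h \<otimes> g i \<otimes> (g h \<otimes> ev [Suc i..<k])"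
    using c by (simp add: m_assoc)
  also have "g h \<otimes> ev [Suc i..<k] = ev [Suc i..<k] \<otimes> g h"
    using assms h by (intro ev_commute) auto
  also have "ev [p..<h] \<otimes> (g h \<otimes> g i \<otimes> (ev [Suc i..<k] \<otimes> g h)) = ev [p..<k] \<otimes> g h"
    using c by (simp add: ev m_assoc)
  finally show ?thesis by (simp add: h)
qed

text \<open>This makes the fixed choice of words compatible with left multiplication. The induction
  removes the largest value, and its place relative to the pair \<open>a\<close>, \<open>b\<close>
  decides the argument: to the left of the pair \<open>g\<close> passes the run of letters with a
  shift of its index, at \<open>b\<close> the run gains one letter, to the right of the pair
  \<open>g\<close> commutes with the run.\<close>

lemma ev_perm_word_ascent:
  assumes "distinct (us @ a # b # vs)" "set (us @ a # b # vs) = {1..k}" "k \<le> n" "a < b"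
  shows "g (Suc (length us)) \<otimes> ev (perm_word k (us @ a # b # vs)) = ev (perm_word k (us @ b # a # vs))"
  using assms
proof (induction k arbitrary: us vs)
  case (Suc k)
  let ?i = "Suc (length us)"
  have len: "length us + length vs + 2 = Suc k"
    using distinct_card[OF Suc.prems(1)] Suc.prems(2) by simp
  have i: "?i \<in> {1..<n}" using len Suc.prems(3) by auto
  have words: "set (perm_word k ws) \<subseteq> {1..<n}" "set [Suc p..<Suc k] \<subseteq> {1..<n}" for ws p
    using perm_word_subset[of k ws] Suc.prems(3) by auto
  have m: "Suc k \<in> set (us @ a # b # vs)" using Suc.prems(2) by simp
  have le: "b \<le> Suc k" using Suc.prems(2) by auto
  have set_k: "set ws = {1..k}" if "insert (Suc k) (set ws) = {1..Suc k}" "Suc k \<notin> set ws" for ws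
    using that by (metis Diff_insert_absorb atLeastAtMostSuc_conv atLeastAtMost_iff le_add1 not_less_eq_eq order_refl plus_1_eq_Suc)
  \<comment> \<open>The largest value cannot be \<open>a\<close>, because
    \<open>a < b\<close>.\<close>
  consider "Suc k \<in> set us" | "b = Suc k" | "Suc k \<in> set vs"
    using m le Suc.prems(4) by auto
  then show ?case
  proof cases
    case 1
    then obtain us1 us2 where us: "us = us1 @ Suc k # us2" by (auto dest: split_list)
    let ?w = "[Suc (length us1)..<Suc k]"
    have eq: "perm_word (Suc k) (us @ x # y # vs) = ?w @ perm_word k ((us1 @ us2) @ x # y # vs)"
      if "x \<noteq> Suc k" "y \<noteq> Suc k" for x y
      using perm_word_split[of k us1 "us2 @ x # y # vs"] Suc.prems(1) that by (simp add: us)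
    have ab: "a \<noteq> Suc k" "b \<noteq> Suc k" using Suc.prems(1) us by auto
    have IH: "g (Suc (length (us1 @ us2))) \<otimes> ev (perm_word k ((us1 @ us2) @ a # b # vs))
        = ev (perm_word k ((us1 @ us2) @ b # a # vs))"
    proof (rule Suc.IH)
      show "set ((us1 @ us2) @ a # b # vs) = {1..k}"
        by (rule set_k) (use Suc.prems(1,2) us in auto)
    qed (use Suc.prems us in auto)
    \<comment> \<open>Removing \<open>Suc k\<close> from the left of the pair moves the pair down by
      one place; \<open>?i - 1\<close> is its index in the shorter list.\<close>
    have "g ?i \<otimes> ev ?w = ev ?w \<otimes> g (?i - 1)"
      by (rule ev_upt_shift) (use us len Suc.prems(3) in auto)
    moreover have "g (?i - 1) \<in> carrier G" using i us by (intro g_closed) auto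
    ultimately have "g ?i \<otimes> ev (?w @ perm_word k ((us1 @ us2) @ a # b # vs)) =
        ev ?w \<otimes> (g (?i - 1) \<otimes> ev (perm_word k ((us1 @ us2) @ a # b # vs)))"
      using g_closed[OF i] ev_closed[OF words(1)] ev_closed[OF words(2)]
      by (simp only: ev_append[OF words(2,1)] m_assoc[symmetric])
    also have "?i - 1 = Suc (length (us1 @ us2))" by (simp add: us)
    finally show ?thesis
      using ab by (simp only: eq not_False_eq_True IH ev_append[OF words(2,1)])
  next
    case 2
    then have "perm_word (Suc k) (us @ a # b # vs) = [Suc ?i..<Suc k] @ perm_word k (us @ a # vs)"
      "perm_word (Suc k) (us @ b # a # vs) = [?i..<Suc k] @ perm_word k (us @ a # vs)"
      using perm_word_split[of k "us @ [a]" vs] perm_word_split[of k us "a # vs"] Suc.prems(1)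
      by (simp_all del: upt_Suc perm_word.simps)
    \<comment> \<open>After the exchange the largest value stands one place further left, which
      costs exactly the letter \<open>?i\<close> in front.\<close>
    moreover have "[?i..<Suc k] = ?i # [Suc ?i..<Suc k]"
      using len by (intro upt_conv_Cons) auto
    ultimately show ?thesis by simp
  next
    case 3
    then obtain vs1 vs2 where vs: "vs = vs1 @ Suc k # vs2" by (auto dest: split_list)
    let ?w = "[Suc (length (us @ a # b # vs1))..<Suc k]"
    have eq: "perm_word (Suc k) (us @ x # y # vs) = [Suc (length (us @ x # y # vs1))..<Suc k] @ perm_word k (us @ x # y # vs1 @ vs2)"
      if "x \<noteq> Suc k" "y \<noteq> Suc k" for x y
      using perm_word_split[of k "us @ x # y # vs1" "vs2"] Suc.prems(1) that
      by (simp add: vs del: upt_Suc perm_word.simps)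
    have ab: "a \<noteq> Suc k" "b \<noteq> Suc k" using Suc.prems(1) vs by auto
    have IH: "g ?i \<otimes> ev (perm_word k (us @ a # b # vs1 @ vs2)) = ev (perm_word k (us @ b # a # vs1 @ vs2))"
    proof (rule Suc.IH)
      show "set (us @ a # b # vs1 @ vs2) = {1..k}"
        by (rule set_k) (use Suc.prems(1,2) vs in auto)
    qed (use Suc.prems vs in auto)
    \<comment> \<open>The largest value stands to the right of both \<open>a\<close> and
      \<open>b\<close>, so the letters of \<open>?w\<close> start at \<open>?i + 2\<close> or
      later.\<close>
    have "g ?i \<otimes> ev ?w = ev ?w \<otimes> g ?i"
      using i words(2) by (intro ev_commute) auto
    then have "g ?i \<otimes> ev (?w @ perm_word k (us @ a # b # vs1 @ vs2)) =
        ev ?w \<otimes> (g ?i \<otimes> ev (perm_word k (us @ a # b # vs1 @ vs2)))"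
      using g_closed[OF i] ev_closed[OF words(1)] ev_closed[OF words(2)]
      by (simp only: ev_append[OF words(2,1)] m_assoc[symmetric])
    then show ?thesis
      using ab by (simp only: eq not_False_eq_True length_append list.size IH ev_append[OF words(2,1)])
  qed
qed simp

end

section \<open>The operators as a representation of \<open>H(S_n)\<close> and of its scalar
  extension\<close>

lemma hecke_hopf_rep:
  obtains \<rho> where "\<rho> \<in> ring_hom (hecke_hopf n) (endo_algebra (id :: laurent \<Rightarrow> laurent))"
    and "\<And>i. i \<in> {1..<n} \<Longrightarrow> \<rho> (hecke_hopf_s n i) = s_op i"
    and "\<And>i. i \<in> {1..<n} \<Longrightarrow> \<rho> (hecke_hopf_D n i) = D_op i"
proof -
  let ?E = "endo_algebra (of_int :: int \<Rightarrow> laurent) :: (int, (nat perm \<Rightarrow> laurent) \<Rightarrow> nat perm \<Rightarrow> laurent) module"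
  define g :: "hecke_hopf_gen \<Rightarrow> (nat perm \<Rightarrow> laurent) \<Rightarrow> nat perm \<Rightarrow> laurent"
    where "g x = (case x of S_gen i \<Rightarrow> s_op i | D_gen i \<Rightarrow> D_op i)" for x
  have E: "assoc_algebra type_ring ?E"
    by (rule assoc_algebra_endo_algebra) simp_all
  have g: "g x \<in> carrier ?E" for x
    by (simp add: g_def s_op_closed D_op_closed split: hecke_hopf_gen.split)
  note hom = alg_homD[OF free_eval_alg_hom[where X = UNIV, OF E g], unfolded free_algebra_ops endo_algebra_simps]
  have diff: "free_eval ?E g (p - q) = (\<lambda>u w. free_eval ?E g p u w - free_eval ?E g q u w)" for p q
    using hom(3)[of "p - q" q] by (simp add: fun_eq_iff)
  have "free_eval ?E g (gen x) = g x" for x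
    by (rule free_eval_gen[where X = UNIV, OF E g]) simp
  then have gen: "free_eval ?E g (gen (S_gen i)) = s_op i" "free_eval ?E g (gen (D_gen i)) = D_op i" for i
    by (simp_all add: g_def)
  have rel: "free_eval ?E g l = free_eval ?E g r" if "hecke_hopf_rel n l r" for l r
    using that
  proof cases
    case (near_sss i j)
    then consider "j = Suc i" | "i = Suc j" by linarith
    then show ?thesis
      by cases (simp_all add: near_sss hom diff gen fun_eq_iff op_near[of _ i] op_near[of _ j])
  next
    case (near_Dss i j)
    then consider "j = Suc i" | "i = Suc j" by linarith
    then show ?thesis
      by cases (simp_all add: near_Dss hom diff gen fun_eq_iff op_near[of _ i] op_near[of _ j])
  next
    case (near_DsD i j)
    then consider "j = Suc i" | "i = Suc j" by linarith
    then show ?thesis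
      by cases (simp_all add: near_DsD hom diff gen fun_eq_iff op_near[of _ i] op_near[of _ j])
  qed (simp_all add: power2_eq_square hom diff gen fun_eq_iff op_quadratic op_far)
  obtain \<rho> where \<rho>: "\<rho> \<in> alg_hom type_ring (presented_algebra (hecke_hopf_gens n) (hecke_hopf_rel n)) ?E"
    and \<rho>_gen: "\<And>x. x \<in> hecke_hopf_gens n \<Longrightarrow> \<rho> (presented_gen (hecke_hopf_gens n) (hecke_hopf_rel n) x) = g x"
    using presented_algebra_hom[OF hecke_hopf_rel_closed E g rel] by blast
  show thesis
  proof (rule that)
    \<comment> \<open>A ring homomorphism does not see the scalar multiplication, in which alone the
      targets for \<open>of_int\<close> and for \<open>id\<close> differ.\<close>
    show "\<rho> \<in> ring_hom (hecke_hopf n) (endo_algebra id)"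
      using alg_homD(6)[OF \<rho>] by (simp add: ring_hom_def hecke_hopf_def endo_algebra_def)
    show "\<rho> (hecke_hopf_s n i) = s_op i" "\<rho> (hecke_hopf_D n i) = D_op i" if "i \<in> {1..<n}" for i
      using that \<rho>_gen[of "S_gen i"] \<rho>_gen[of "D_gen i"]
      by (simp_all add: hecke_hopf_s_def hecke_hopf_D_def hecke_hopf_gens_def g_def)
  qed
qed

lemma assoc_algebra_endo_algebra_id:
  "assoc_algebra type_ring (endo_algebra id :: ('k::comm_ring_1, ('i \<Rightarrow> 'k) \<Rightarrow> 'i \<Rightarrow> 'k) module)"
  by (rule assoc_algebra_endo_algebra) simp_all

lemma hecke_hopf_laurent_rep:
  obtains \<Psi> where "\<Psi> \<in> alg_hom laurent_ring (hecke_hopf_laurent n) (endo_algebra id)"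
    and "\<And>i. i \<in> {1..<n} \<Longrightarrow> \<Psi> (hecke_image n i) = (\<lambda>u w. s_op i u w + (1 - \<q>) * D_op i u w)"
proof -
  obtain \<rho> where \<rho>: "\<rho> \<in> ring_hom (hecke_hopf n) (endo_algebra (id :: laurent \<Rightarrow> laurent))"
    and \<rho>_gen: "\<And>i. i \<in> {1..<n} \<Longrightarrow> \<rho> (hecke_hopf_s n i) = s_op i"
      "\<And>i. i \<in> {1..<n} \<Longrightarrow> \<rho> (hecke_hopf_D n i) = D_op i"
    using hecke_hopf_rep by blast
  obtain \<Psi> where \<Psi>: "\<Psi> \<in> alg_hom laurent_ring (tensor_algebra (hecke_hopf n) laurent_ring) (endo_algebra id)"
    and pure: "\<And>a b. \<lbrakk>a \<in> carrier (hecke_hopf n); b \<in> carrier laurent_ring\<rbrakk> \<Longrightarrow>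
      \<Psi> (pure_tensor (hecke_hopf n) laurent_ring a b) = b \<odot>\<^bsub>endo_algebra id\<^esub> \<rho> a"
    using tensor_algebra_hom[OF ring_hecke_hopf cring_type_ring assoc_algebra_endo_algebra_id \<rho>] by blast
  interpret T: assoc_algebra laurent_ring "hecke_hopf_laurent n"
    by (rule assoc_algebra_hecke_hopf_laurent)
  note \<Psi>' = \<Psi>[folded hecke_hopf_laurent_def]
  show thesis
  proof (rule that[OF \<Psi>'])
    fix i assume i: "i \<in> {1..<n}"
    have mem: "hecke_hopf_s n i \<in> carrier (hecke_hopf n)" "hecke_hopf_D n i \<in> carrier (hecke_hopf n)"
      using i presented_gen_closed[OF hecke_hopf_rel_closed]
      by (simp_all add: hecke_hopf_s_def hecke_hopf_D_def hecke_hopf_def hecke_hopf_gens_def)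
    have "hecke_hopf_embed n a \<in> carrier (hecke_hopf_laurent n)" if "a \<in> carrier (hecke_hopf n)" for a
      using pure_tensor_closed[OF ring_hecke_hopf cring_type_ring that]
      by (simp add: hecke_hopf_embed_def hecke_hopf_laurent_def)
    then show "\<Psi> (hecke_image n i) = (\<lambda>u w. s_op i u w + (1 - \<q>) * D_op i u w)"
      using mem i by (simp add: hecke_image_def alg_homD[OF \<Psi>'] hecke_hopf_embed_def pure \<rho>_gen
          endo_algebra_simps)
  qed
qed

section \<open>The Hecke algebra as a quotient of the regular representation\<close>

context
  fixes n :: nat
begin

interpretation H: assoc_algebra laurent_ring "hecke_algebra n"
  by (rule assoc_algebra_hecke_algebra)

private abbreviation (input) "H \<equiv> hecke_algebra n"

private definition qinv :: laurent where "qinv = Poly_Mapping.single (- 1) 1"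

private lemma q_qinv: "\<q> * qinv = 1" "qinv * \<q> = 1"
  by (simp_all add: laurent_q_def qinv_def mult_single)

private lemma T_closed: "i \<in> {1..<n} \<Longrightarrow> hecke_T n i \<in> carrier H"
  unfolding hecke_T_def hecke_algebra_def by (rule presented_gen_closed[OF hecke_rel_closed])

private lemma hecke_relations:
  shows T_braid: "\<lbrakk>i \<in> {1..<n}; Suc i \<in> {1..<n}\<rbrakk> \<Longrightarrow>
      hecke_T n i \<otimes>\<^bsub>H\<^esub> hecke_T n (Suc i) \<otimes>\<^bsub>H\<^esub> hecke_T n i = hecke_T n (Suc i) \<otimes>\<^bsub>H\<^esub> hecke_T n i \<otimes>\<^bsub>H\<^esub> hecke_T n (Suc i)"
    and T_commute: "\<lbrakk>i \<in> {1..<n}; j \<in> {1..<n}; Suc i < j\<rbrakk> \<Longrightarrow> hecke_T n i \<otimes>\<^bsub>H\<^esub> hecke_T n j = hecke_T n j \<otimes>\<^bsub>H\<^esub> hecke_T n i"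
    and T_quadratic: "i \<in> {1..<n} \<Longrightarrow>
      hecke_T n i \<otimes>\<^bsub>H\<^esub> hecke_T n i = (1 - \<q>) \<odot>\<^bsub>H\<^esub> hecke_T n i \<oplus>\<^bsub>H\<^esub> \<q> \<odot>\<^bsub>H\<^esub> \<one>\<^bsub>H\<^esub>"
proof -
  define \<pi> where "\<pi> = (+>\<^bsub>free_algebra {1..<n}\<^esub>) (relations_ideal {1..<n} (hecke_rel n))"
  have "\<pi> \<in> alg_hom laurent_ring (free_algebra {1..<n}) H"
    unfolding \<pi>_def hecke_algebra_def by (rule presented_algebra_proj[OF hecke_rel_closed])
  note hom = alg_homD[OF this, unfolded free_algebra_ops]
  have gen: "\<pi> (gen i) = hecke_T n i" for i
    by (simp add: \<pi>_def hecke_T_def presented_gen_def)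
  have rel: "\<pi> l = \<pi> r" if "hecke_rel n l r" for l r
    unfolding \<pi>_def by (rule presented_algebra_relation, erule hecke_rel_closed, rule that)
  have const: "\<pi> (Poly_Mapping.single 0 c) = c \<odot>\<^bsub>H\<^esub> \<one>\<^bsub>H\<^esub>" for c
    using hom(5)[of c 1] hom(4) by (simp add: free_algebra_one_closed)
  show "hecke_T n i \<otimes>\<^bsub>H\<^esub> hecke_T n (Suc i) \<otimes>\<^bsub>H\<^esub> hecke_T n i = hecke_T n (Suc i) \<otimes>\<^bsub>H\<^esub> hecke_T n i \<otimes>\<^bsub>H\<^esub> hecke_T n (Suc i)"
    if "i \<in> {1..<n}" "Suc i \<in> {1..<n}"
    using rel[OF hecke_rel.braid[of i n "Suc i"]] that
    by (simp add: hom(2) gen free_algebra_closed)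
  show "hecke_T n i \<otimes>\<^bsub>H\<^esub> hecke_T n j = hecke_T n j \<otimes>\<^bsub>H\<^esub> hecke_T n i" if "i \<in> {1..<n}" "j \<in> {1..<n}" "Suc i < j"
    using rel[OF hecke_rel.commute[of i n j]] that
    by (simp add: hom(2) gen free_algebra_closed)
  show "hecke_T n i \<otimes>\<^bsub>H\<^esub> hecke_T n i = (1 - \<q>) \<odot>\<^bsub>H\<^esub> hecke_T n i \<oplus>\<^bsub>H\<^esub> \<q> \<odot>\<^bsub>H\<^esub> \<one>\<^bsub>H\<^esub>" if i: "i \<in> {1..<n}"
    using rel[OF hecke_rel.quadratic[OF i]] i H.smult_mult_left[of "1 - \<q>" "\<one>\<^bsub>H\<^esub>" "hecke_T n i"] T_closed[OF i]
    by (simp add: power2_eq_square hom(2,3,5) gen const free_algebra_closed)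
qed

text \<open>The braid and commutation relations are homogeneous, so they survive the factor
  \<open>q^(-1)\<close>. A word of length \<open>l\<close> in the \<open>V i\<close> is
  \<open>q^(-l)\<close> times the same word in the \<open>T_i\<close>, and this yields the power of
  \<open>q\<close> in \<open>\<tau>\<close>.\<close>

private definition V where "V i = qinv \<odot>\<^bsub>H\<^esub> hecke_T n i"

private lemma V_closed: "i \<in> {1..<n} \<Longrightarrow> V i \<in> carrier H"
  by (simp add: V_def T_closed)

interpretation V: braid_family H V n
proof unfold_locales
  show "V i \<otimes>\<^bsub>H\<^esub> V (Suc i) \<otimes>\<^bsub>H\<^esub> V i = V (Suc i) \<otimes>\<^bsub>H\<^esub> V i \<otimes>\<^bsub>H\<^esub> V (Suc i)"
    if "i \<in> {1..<n}" "Suc i \<in> {1..<n}" for i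
    using that T_closed[of i] T_closed[of "Suc i"] T_braid[of i]
    by (simp add: V_def H.smult_mult_left H.smult_mult_right)
  show "V i \<otimes>\<^bsub>H\<^esub> V j = V j \<otimes>\<^bsub>H\<^esub> V i" if "i \<in> {1..<n}" "j \<in> {1..<n}" "Suc i < j" for i j
    using that T_closed[of i] T_closed[of j] T_commute[of i j]
    by (simp add: V_def H.smult_mult_left H.smult_mult_right)
qed (rule V_closed)

section \<open>The symmetric group inside \<open>nat perm\<close> and the elements
  \<open>\<tau>\<close>\<close>

private definition perms :: "nat perm set" where "perms = {w. affected w \<subseteq> {1..n}}"

text \<open>The letters act on places, that is, on \<open>w\<close> from the right, and the last
  letter of the word acts first. Read from left to right, the word therefore spells the inverse of
  \<open>w\<close>.\<close>

private definition \<tau> where "\<tau> w = word_eval H V (perm_word n (map ((\<langle>$\<rangle>) w) [1..<Suc n]))"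

private lemma \<tau>_closed: "\<tau> w \<in> carrier H"
  unfolding \<tau>_def by (rule V.ev_closed[OF perm_word_subset])

private lemma \<tau>_one: "\<tau> 1 = \<one>\<^bsub>H\<^esub>"
  by (simp only: \<tau>_def apply_one list.map_id perm_word_id word_eval_simps list.map_ident id_def)

private lemma perms_permutes: "w \<in> perms \<Longrightarrow> (\<langle>$\<rangle>) w permutes {1..n}"
  using bij_apply[of w] by (auto simp: permutes_def perms_def in_affected subset_iff bij_iff)

private lemma finite_perms: "finite perms"
proof -
  have "finite ((\<langle>$\<rangle>) ` perms)"
    by (rule finite_subset[OF _ finite_permutations[of "{1..n}"]]) (use perms_permutes in auto)
  moreover have "inj_on (\<langle>$\<rangle>) perms"
    by (rule inj_onI) (simp add: perm_eq_iff)
  ultimately show ?thesis by (rule finite_imageD)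
qed

private lemma perms_swap: "w \<in> perms \<Longrightarrow> i \<in> {1..<n} \<Longrightarrow> w * \<langle>i \<leftrightarrow> Suc i\<rangle> \<in> perms"
  using affected_times[of w "\<langle>i \<leftrightarrow> Suc i\<rangle>"] by (auto simp: perms_def affected_swap)

private lemma V_ascent:
  assumes w: "w \<in> perms" and i: "i \<in> {1..<n}" and less: "w \<langle>$\<rangle> i < w \<langle>$\<rangle> (Suc i)"
  shows "V i \<otimes>\<^bsub>H\<^esub> \<tau> w = \<tau> (w * \<langle>i \<leftrightarrow> Suc i\<rangle>)"
proof -
  let ?us = "map ((\<langle>$\<rangle>) w) [1..<i]" and ?vs = "map ((\<langle>$\<rangle>) w) [Suc (Suc i)..<Suc n]"
  have "[1..<Suc n] = [1..<i] @ i # Suc i # [Suc (Suc i)..<Suc n]"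
    using i upt_add_eq_append[of 1 i "Suc n - i"] by (simp add: upt_conv_Cons del: upt_Suc)
  then have w_list: "map ((\<langle>$\<rangle>) w) [1..<Suc n] = ?us @ w \<langle>$\<rangle> i # w \<langle>$\<rangle> (Suc i) # ?vs"
    and ws_list: "map ((\<langle>$\<rangle>) (w * \<langle>i \<leftrightarrow> Suc i\<rangle>)) [1..<Suc n] = ?us @ w \<langle>$\<rangle> (Suc i) # w \<langle>$\<rangle> i # ?vs"
    by (simp_all add: apply_times del: upt_Suc)
  have "distinct (map ((\<langle>$\<rangle>) w) [1..<Suc n])"
    by (simp add: distinct_map inj_on_def apply_inj del: upt_Suc)
  moreover have "set (map ((\<langle>$\<rangle>) w) [1..<Suc n]) = {1..n}"
    using permutes_image[OF perms_permutes[OF w]] by (simp add: atLeastLessThanSuc_atLeastAtMost del: upt_Suc)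
  ultimately have "V (Suc (length ?us)) \<otimes>\<^bsub>H\<^esub> \<tau> w = \<tau> (w * \<langle>i \<leftrightarrow> Suc i\<rangle>)"
    unfolding \<tau>_def w_list ws_list using less by (intro V.ev_perm_word_ascent) simp_all
  then show ?thesis using i by simp
qed

private lemma T_ascent:
  assumes w: "w \<in> perms" and i: "i \<in> {1..<n}" and less: "w \<langle>$\<rangle> i < w \<langle>$\<rangle> (Suc i)"
  shows "hecke_T n i \<otimes>\<^bsub>H\<^esub> \<tau> w = \<q> \<odot>\<^bsub>H\<^esub> \<tau> (w * \<langle>i \<leftrightarrow> Suc i\<rangle>)"
proof -
  have "\<q> \<odot>\<^bsub>H\<^esub> \<tau> (w * \<langle>i \<leftrightarrow> Suc i\<rangle>) = \<q> \<odot>\<^bsub>H\<^esub> (qinv \<odot>\<^bsub>H\<^esub> (hecke_T n i \<otimes>\<^bsub>H\<^esub> \<tau> w))"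
    using T_closed[OF i] \<tau>_closed by (simp add: V_ascent[OF assms, symmetric] V_def H.smult_mult_left)
  also have "\<dots> = hecke_T n i \<otimes>\<^bsub>H\<^esub> \<tau> w"
    using T_closed[OF i] \<tau>_closed H.smult_assoc1[of \<q> qinv] H.smult_one by (simp add: q_qinv)
  finally show ?thesis by simp
qed

text \<open>The permutation \<open>v = w s_i\<close> has an ascent at \<open>i\<close>, and
  \<open>T_i \<tau>_v = q \<tau>_w\<close>. Applying \<open>T_i\<close> again and using the
  quadratic relation gives \<open>q T_i \<tau>_w = (1 - q) q \<tau>_w + q \<tau>_v\<close>, from
  which the unit \<open>q\<close> is cancelled.\<close>

private lemma T_descent:
  assumes w: "w \<in> perms" and i: "i \<in> {1..<n}" and less: "w \<langle>$\<rangle> (Suc i) < w \<langle>$\<rangle> i"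
  shows "hecke_T n i \<otimes>\<^bsub>H\<^esub> \<tau> w = \<tau> (w * \<langle>i \<leftrightarrow> Suc i\<rangle>) \<oplus>\<^bsub>H\<^esub> (1 - \<q>) \<odot>\<^bsub>H\<^esub> \<tau> w"
proof -
  let ?v = "w * \<langle>i \<leftrightarrow> Suc i\<rangle>"
  have v: "?v \<in> perms" "?v \<langle>$\<rangle> i < ?v \<langle>$\<rangle> (Suc i)" "?v * \<langle>i \<leftrightarrow> Suc i\<rangle> = w"
    using less perms_swap[OF w i] by (simp_all add: apply_times mult.assoc swap_swap)
  note closed = T_closed[OF i] \<tau>_closed
  have Tv: "hecke_T n i \<otimes>\<^bsub>H\<^esub> \<tau> ?v = \<q> \<odot>\<^bsub>H\<^esub> \<tau> w"
    using T_ascent[OF v(1) i v(2)] v(3) by simp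
  have "\<q> \<odot>\<^bsub>H\<^esub> (hecke_T n i \<otimes>\<^bsub>H\<^esub> \<tau> w) = (hecke_T n i \<otimes>\<^bsub>H\<^esub> hecke_T n i) \<otimes>\<^bsub>H\<^esub> \<tau> ?v"
    using closed by (simp add: H.m_assoc Tv H.smult_mult_right)
  also have "\<dots> = \<q> \<odot>\<^bsub>H\<^esub> (\<tau> ?v \<oplus>\<^bsub>H\<^esub> (1 - \<q>) \<odot>\<^bsub>H\<^esub> \<tau> w)"
    using closed H.smult_assoc1[of "1 - \<q>" \<q> "\<tau> w"] H.smult_assoc1[of \<q> "1 - \<q>" "\<tau> w"]
    by (simp add: T_quadratic[OF i] H.l_distr H.smult_mult_left Tv H.smult_r_distr H.a_comm mult.commute)
  finally have "qinv \<odot>\<^bsub>H\<^esub> (\<q> \<odot>\<^bsub>H\<^esub> (hecke_T n i \<otimes>\<^bsub>H\<^esub> \<tau> w)) = qinv \<odot>\<^bsub>H\<^esub> (\<q> \<odot>\<^bsub>H\<^esub> (\<tau> ?v \<oplus>\<^bsub>H\<^esub> (1 - \<q>) \<odot>\<^bsub>H\<^esub> \<tau> w))"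
    by simp
  then show ?thesis
    using closed H.smult_assoc1[of qinv \<q>, symmetric] H.smult_one by (simp add: q_qinv)
qed

text \<open>The sum drops the values of \<open>u\<close> outside \<open>S_n\<close>. This is
  compatible with the operators for \<open>i < n\<close>, since they relate the values at
  \<open>w\<close> and \<open>w s_i\<close> only, and right multiplication by \<open>s_i\<close>
  preserves \<open>S_n\<close>.\<close>

private definition \<theta> where "\<theta> u = (\<Oplus>\<^bsub>H\<^esub>w\<in>perms. u w \<odot>\<^bsub>H\<^esub> \<tau> w)"

private lemma \<theta>_closed: "\<theta> u \<in> carrier H"
  unfolding \<theta>_def by (rule H.finsum_closed) (simp add: \<tau>_closed)

private lemma \<theta>_add: "\<theta> (\<lambda>w. u w + v w) = \<theta> u \<oplus>\<^bsub>H\<^esub> \<theta> v"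
  using H.finsum_addf[of "\<lambda>w. u w \<odot>\<^bsub>H\<^esub> \<tau> w" perms "\<lambda>w. v w \<odot>\<^bsub>H\<^esub> \<tau> w"] \<tau>_closed
    H.smult_l_distr[of "u _" "v _" "\<tau> _"]
  by (simp add: \<theta>_def)

private lemma \<theta>_smult: "\<theta> (\<lambda>w. c * u w) = c \<odot>\<^bsub>H\<^esub> \<theta> u"
  using H.finsum_smult_ldistr[OF finite_perms, of c "\<lambda>w. u w \<odot>\<^bsub>H\<^esub> \<tau> w"] \<tau>_closed
    H.smult_assoc1[of c "u _" "\<tau> _"]
  by (simp add: \<theta>_def)

private lemma \<theta>_delta: "\<theta> (\<lambda>w. if w = 1 then 1 else 0) = \<one>\<^bsub>H\<^esub>"
proof -
  have one: "1 \<in> perms" by (simp add: perms_def)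
  have "\<theta> (\<lambda>w. if w = 1 then 1 else 0) = (\<Oplus>\<^bsub>H\<^esub>w\<in>perms. if 1 = w then \<tau> w else \<zero>\<^bsub>H\<^esub>)"
    unfolding \<theta>_def using H.smult_one[of "\<tau> _"] H.smult_l_null[of "\<tau> _"] \<tau>_closed
    by (intro H.finsum_cong') auto
  also have "\<dots> = \<tau> 1"
    by (rule H.add.finprod_singleton) (simp_all add: one finite_perms \<tau>_closed)
  finally show ?thesis by (simp add: \<tau>_one)
qed

private lemma \<theta>_reindex:
  assumes "i \<in> {1..<n}"
  shows "(\<Oplus>\<^bsub>H\<^esub>w\<in>perms. u w \<odot>\<^bsub>H\<^esub> \<tau> (w * \<langle>i \<leftrightarrow> Suc i\<rangle>)) = \<theta> (\<lambda>w. u (w * \<langle>i \<leftrightarrow> Suc i\<rangle>))"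
proof -
  let ?s = "\<lambda>w. w * \<langle>i \<leftrightarrow> Suc i\<rangle>"
  have ss: "?s (?s w) = w" for w by (simp add: mult.assoc swap_swap)
  have img: "?s ` perms = perms"
    using perms_swap[OF _ assms] ss by (metis (no_types, lifting) image_eqI image_subsetI subsetI subset_antisym)
  have inj: "inj_on ?s perms" by (metis inj_onI ss)
  have "(\<Oplus>\<^bsub>H\<^esub>w\<in>?s ` perms. u (?s w) \<odot>\<^bsub>H\<^esub> \<tau> w) = (\<Oplus>\<^bsub>H\<^esub>w\<in>perms. u (?s (?s w)) \<odot>\<^bsub>H\<^esub> \<tau> (?s w))"
    by (rule H.finsum_reindex[OF _ inj]) (simp add: \<tau>_closed)
  then show ?thesis unfolding \<theta>_def by (simp add: img ss)
qed

text \<open>Here the operators meet the Hecke multiplication: \<open>T_i \<tau>_w = \<alpha>(w)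
  \<tau>_(w s_i) + \<beta>(w) \<tau>_w\<close>. After reindexing, \<open>\<tau>_w\<close> has the
  coefficient \<open>u(w s_i) \<alpha>(w s_i) + u(w) \<beta>(w)\<close>. This is
  \<open>q u(w s_i) + (1 - q) u(w)\<close> at a descent of \<open>w\<close> and
  \<open>u(w s_i)\<close> at an ascent, as for \<open>s_i + (1 - q) D_i\<close>.\<close>

private lemma \<theta>_T:
  assumes i: "i \<in> {1..<n}"
  shows "\<theta> (\<lambda>w. s_op i u w + (1 - \<q>) * D_op i u w) = hecke_T n i \<otimes>\<^bsub>H\<^esub> \<theta> u"
proof -
  let ?s = "\<lambda>w. w * \<langle>i \<leftrightarrow> Suc i\<rangle>"
  define \<alpha> where "\<alpha> w = (if w \<langle>$\<rangle> (Suc i) < w \<langle>$\<rangle> i then 1 else \<q>)" for w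
  define \<beta> where "\<beta> w = (if w \<langle>$\<rangle> (Suc i) < w \<langle>$\<rangle> i then 1 - \<q> else 0)" for w
  note closed = T_closed[OF i] \<tau>_closed
  have T\<tau>: "hecke_T n i \<otimes>\<^bsub>H\<^esub> (u w \<odot>\<^bsub>H\<^esub> \<tau> w) = (u w * \<alpha> w) \<odot>\<^bsub>H\<^esub> \<tau> (?s w) \<oplus>\<^bsub>H\<^esub> (u w * \<beta> w) \<odot>\<^bsub>H\<^esub> \<tau> w"
    if w: "w \<in> perms" for w
  proof (cases "w \<langle>$\<rangle> (Suc i) < w \<langle>$\<rangle> i")
    case True
    then show ?thesis
      using closed T_descent[OF w i] H.smult_assoc1[of "u w" "1 - \<q>" "\<tau> w"]
      by (simp add: \<alpha>_def \<beta>_def H.smult_mult_right H.smult_r_distr)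
  next
    case False
    moreover have "w \<langle>$\<rangle> i \<noteq> w \<langle>$\<rangle> (Suc i)" by (simp add: apply_inj)
    ultimately show ?thesis
      using closed T_ascent[OF w i] H.smult_assoc1[of "u w" \<q> "\<tau> (?s w)"] H.smult_l_null[of "\<tau> w"]
      by (simp add: \<alpha>_def \<beta>_def H.smult_mult_right)
  qed
  have "hecke_T n i \<otimes>\<^bsub>H\<^esub> \<theta> u = (\<Oplus>\<^bsub>H\<^esub>w\<in>perms. hecke_T n i \<otimes>\<^bsub>H\<^esub> (u w \<odot>\<^bsub>H\<^esub> \<tau> w))"
    unfolding \<theta>_def by (rule H.finsum_rdistr[OF finite_perms]) (simp_all add: closed)
  also have "\<dots> = (\<Oplus>\<^bsub>H\<^esub>w\<in>perms. (u w * \<alpha> w) \<odot>\<^bsub>H\<^esub> \<tau> (?s w) \<oplus>\<^bsub>H\<^esub> (u w * \<beta> w) \<odot>\<^bsub>H\<^esub> \<tau> w)"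
    by (rule H.finsum_cong') (simp_all add: T\<tau> closed)
  also have "\<dots> = (\<Oplus>\<^bsub>H\<^esub>w\<in>perms. (u w * \<alpha> w) \<odot>\<^bsub>H\<^esub> \<tau> (?s w)) \<oplus>\<^bsub>H\<^esub> \<theta> (\<lambda>w. u w * \<beta> w)"
    unfolding \<theta>_def by (rule H.finsum_addf) (simp_all add: closed)
  also have "\<dots> = \<theta> (\<lambda>w. u (?s w) * \<alpha> (?s w) + u w * \<beta> w)"
    using \<theta>_reindex[OF i, of "\<lambda>w. u w * \<alpha> w"] by (simp add: \<theta>_add)
  also have "(\<lambda>w. u (?s w) * \<alpha> (?s w) + u w * \<beta> w) = (\<lambda>w. s_op i u w + (1 - \<q>) * D_op i u w)"
  proof
    fix w
    have "w \<langle>$\<rangle> i \<noteq> w \<langle>$\<rangle> (Suc i)" by (simp add: apply_inj)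
    then show "u (?s w) * \<alpha> (?s w) + u w * \<beta> w = s_op i u w + (1 - \<q>) * D_op i u w"
      by (auto simp: s_op_def D_op_def \<alpha>_def \<beta>_def apply_times algebra_simps)
  qed
  finally show ?thesis by simp
qed

lemma hecke_rep_faithful:
  assumes \<Phi>: "\<Phi> \<in> alg_hom laurent_ring (hecke_algebra n) (endo_algebra id)"
    and gen: "\<And>i. i \<in> {1..<n} \<Longrightarrow> \<Phi> (hecke_T n i) = (\<lambda>u w. s_op i u w + (1 - \<q>) * D_op i u w)"
  shows "inj_on \<Phi> (carrier (hecke_algebra n))"
proof -
  note hom = alg_homD[OF \<Phi>, unfolded endo_algebra_simps]
  \<comment> \<open>The quantifier over \<open>u\<close> stays inside the induction because the
    product case applies the hypothesis for the left factor to the function obtained from the right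
    factor.\<close>
  have \<theta>_\<Phi>: "\<forall>u. \<theta> (\<Phi> x u) = x \<otimes>\<^bsub>H\<^esub> \<theta> u" if "x \<in> carrier H" for x
  proof (rule presented_algebra_induct[where X = "{1..<n}" and rel = "hecke_rel n" and x = x
          and P = "\<lambda>x. \<forall>u. \<theta> (\<Phi> x u) = x \<otimes>\<^bsub>H\<^esub> \<theta> u",
        OF hecke_rel_closed, folded hecke_algebra_def])
    show "\<forall>u. \<theta> (\<Phi> (c \<odot>\<^bsub>H\<^esub> \<one>\<^bsub>H\<^esub>) u) = (c \<odot>\<^bsub>H\<^esub> \<one>\<^bsub>H\<^esub>) \<otimes>\<^bsub>H\<^esub> \<theta> u" for c
      using H.smult_mult_left[of c "\<one>\<^bsub>H\<^esub>"] by (simp add: hom \<theta>_smult \<theta>_closed)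
    show "\<forall>u. \<theta> (\<Phi> (presented_gen {1..<n} (hecke_rel n) i) u) = presented_gen {1..<n} (hecke_rel n) i \<otimes>\<^bsub>H\<^esub> \<theta> u"
      if "i \<in> {1..<n}" for i
      using gen[OF that] \<theta>_T[OF that] by (simp add: hecke_T_def)
  qed (use that in \<open>simp_all add: hom \<theta>_add \<theta>_closed H.l_distr H.m_assoc\<close>)
  show ?thesis
  proof (rule inj_onI)
    fix x y assume xy: "x \<in> carrier H" "y \<in> carrier H" "\<Phi> x = \<Phi> y"
    let ?\<delta> = "\<lambda>w. if w = 1 then 1 else 0"
    have "x = \<theta> (\<Phi> x ?\<delta>)" using \<theta>_\<Phi>[OF xy(1)] xy(1) by (simp add: \<theta>_delta)
    also have "\<dots> = y" using \<theta>_\<Phi>[OF xy(2)] xy by (simp add: \<theta>_delta)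
    finally show "x = y" .
  qed
qed

end

text \<open>The last clause expresses that the values on the generators define the homomorphism.
  Agreement is asserted on the carrier, since a function in \<open>alg_hom\<close> may take
  arbitrary values elsewhere.\<close>

theorem theorem1p9:
  fixes n :: nat
  assumes "n \<ge> 2"
  shows "\<exists>\<phi> \<in> alg_hom laurent_ring (hecke_algebra n) (hecke_hopf_laurent n).
    (\<forall>i\<in>{1..<n}. \<phi> (hecke_T n i) =
       hecke_hopf_embed n (hecke_hopf_s n i) \<oplus>\<^bsub>hecke_hopf_laurent n\<^esub>
       (1 - \<q>) \<odot>\<^bsub>hecke_hopf_laurent n\<^esub> hecke_hopf_embed n (hecke_hopf_D n i)) \<and>
    inj_on \<phi> (carrier (hecke_algebra n)) \<and>
    (\<forall>\<psi> \<in> alg_hom laurent_ring (hecke_algebra n) (hecke_hopf_laurent n).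
       (\<forall>i\<in>{1..<n}. \<psi> (hecke_T n i) = \<phi> (hecke_T n i)) \<longrightarrow>
       (\<forall>x\<in>carrier (hecke_algebra n). \<psi> x = \<phi> x))"
proof -
  obtain \<phi> where \<phi>: "\<phi> \<in> alg_hom laurent_ring (hecke_algebra n) (hecke_hopf_laurent n)"
    and \<phi>_T: "\<And>i. i \<in> {1..<n} \<Longrightarrow> \<phi> (hecke_T n i) = hecke_image n i"
    using presented_algebra_hom[OF hecke_rel_closed assoc_algebra_hecke_hopf_laurent hecke_image_closed
        hecke_image_rel] unfolding hecke_algebra_def hecke_T_def by blast
  obtain \<Psi> where \<Psi>: "\<Psi> \<in> alg_hom laurent_ring (hecke_hopf_laurent n) (endo_algebra id)"
    and \<Psi>_image: "\<And>i. i \<in> {1..<n} \<Longrightarrow> \<Psi> (hecke_image n i) = (\<lambda>u w. s_op i u w + (1 - \<q>) * D_op i u w)"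
    using hecke_hopf_laurent_rep by blast
  \<comment> \<open>The composite is the action of the Hecke algebra on functions; its injectivity
    forces that of the first map.\<close>
  have "inj_on (\<lambda>x. \<Psi> (\<phi> x)) (carrier (hecke_algebra n))"
    by (rule hecke_rep_faithful[OF alg_hom_comp[OF \<phi> \<Psi>]]) (simp add: \<phi>_T \<Psi>_image)
  then have "inj_on \<phi> (carrier (hecke_algebra n))"
    by (auto simp: inj_on_def)
  moreover have "\<psi> x = \<phi> x"
    if "\<psi> \<in> alg_hom laurent_ring (hecke_algebra n) (hecke_hopf_laurent n)"
      "\<forall>i\<in>{1..<n}. \<psi> (hecke_T n i) = \<phi> (hecke_T n i)" "x \<in> carrier (hecke_algebra n)" for \<psi> x
    using presented_algebra_hom_unique[where X = "{1..<n}" and rel = "hecke_rel n", OF hecke_rel_closed,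
        of \<psi> "hecke_hopf_laurent n" \<phi> x] that \<phi>
    by (simp add: hecke_algebra_def hecke_T_def)
  ultimately show ?thesis
    using \<phi> \<phi>_T by (intro bexI[of _ \<phi>]) (auto simp: hecke_image_def)
qed

end
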